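(* Let $X$ be a geodesic Ptolemy metric space and let $\Gamma \subset \mathrm{ISO}(X)$ be a subgroup of the isometry group of $X$ which is a crystallographic group of rank $n$ and which acts properly and cocompactly on $X$. Then there exist an action of $\Gamma$ on $\mathbb{R}^n$ by Euclidean isometries with compact quotient and a continuous rough isometry $\varphi: X \to \mathbb{R}^n$ which is equivariant, i.e. $\varphi(\gamma x) = \gamma \varphi(x)$ for all $\gamma \in \Gamma$ and $x \in X$.
   Context: Metric spaces are nonempty; $|xy|$ denotes the distance between $x$ and $y$. A metric space $X$ is a Ptolemy metric space if $|xy|\,|uv| \le |xu|\,|yv| + |xv|\,|yu|$ for all $x,y,u,v \in X$. It is geodesic if any two points $x,y$ can be joined by a geodesic, i.e. a map $c:[a,b]\to X$ from $x$ to $y$ such that for some constant $\lambda \ge 0$, $|c(t)c(s)| = \lambda|t-s|$ for all $s,t$. $\mathrm{ISO}(X)$ is the isometry group of $X$. An isometric action of a group $\Gamma$ on $X$ is proper if for every $x \in X$ there is $r>0$ such that $\{\gamma \in \Gamma : |x\,\gamma(x)| < r\}$ is finite. It is cocompact if there is a compact subset $K \subset X$ with $X = \Gamma K$. A group is crystallographic of rank $n$ if it is isomorphic, as an abstract group, to a discrete, cocompact subgroup of $\mathrm{ISO}(\mathbb{R}^n)$, where $\mathbb{R}^n$ carries the Euclidean metric. A map $\varphi: X \to Y$ between metric spaces is a rough isometry if there is a constant $A \ge 0$ such that $|xx'| - A \le |\varphi(x)\varphi(x')| \le |xx'| + A$ for all $x,x' \in X$, and for every $y \in Y$ there is $x \in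 X$ with $|y\,\varphi(x)| \le A$. *)

theory Defs
  imports "HOL-Analysis.Analysis" "HOL-Algebra.Group"
begin

definition ptolemy_space :: "'a::metric_space itself \<Rightarrow> bool" where
  "ptolemy_space _ \<longleftrightarrow>
     (\<forall>x y u v :: 'a. dist x y * dist u v \<le> dist x u * dist y v + dist x v * dist y u)"

definition geodesic_between :: "(real \<Rightarrow> 'a::metric_space) \<Rightarrow> real \<Rightarrow> real \<Rightarrow> 'a \<Rightarrow> 'a \<Rightarrow> bool" where
  "geodesic_between c a b x y \<longleftrightarrow>
     a \<le> b \<and> c a = x \<and> c b = y \<and>
     (\<exists>l\<ge>0. \<forall>s\<in>{a..b}. \<forall>t\<in>{a..b}. dist (c t) (c s) = l * \<bar>t - s\<bar>)"

definition geodesic_space :: "'a::metric_space itself \<Rightarrow> bool" where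
  "geodesic_space _ \<longleftrightarrow> (\<forall>x y :: 'a. \<exists>c a b. geodesic_between c a b x y)"

definition isometry_group :: "('a::metric_space \<Rightarrow> 'a) monoid" where
  "isometry_group =
     \<lparr>carrier = {f. bij f \<and> (\<forall>x y. dist (f x) (f y) = dist x y)},
      mult = (\<circ>),
      one = id\<rparr>"

lemma group_isometry_group: "group isometry_group"
proof (rule groupI)
  fix f :: "'a \<Rightarrow> 'a"
  assume "f \<in> carrier isometry_group"
  then have f: "bij f" and iso: "\<And>x y. dist (f x) (f y) = dist x y"
    by (auto simp: isometry_group_def)
  have "dist (inv_into UNIV f x) (inv_into UNIV f y) = dist x y" for x y
    using iso[of "inv_into UNIV f x" "inv_into UNIV f y"] f by (simp add: bij_is_surj surj_f_inv_f)
  then have "inv_into UNIV f \<in> carrier isometry_group"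
    using f by (auto simp: isometry_group_def bij_imp_bij_inv)
  moreover have "inv_into UNIV f \<circ> f = id"
    using f by (simp add: bij_is_inj)
  ultimately show "\<exists>g\<in>carrier isometry_group. g \<otimes>\<^bsub>isometry_group\<^esub> f = \<one>\<^bsub>isometry_group\<^esub>"
    by (auto simp: isometry_group_def)
qed (auto simp: isometry_group_def bij_comp comp_assoc)

text \<open>
  An isometric action of a group \<open>G\<close> on a metric space is a homomorphism
  \<open>\<rho>\<close> from \<open>G\<close> to the isometry group.  A subgroup of the isometry group acts
  tautologically, by \<open>\<rho> = (\<lambda>\<gamma>. \<gamma>)\<close>.
\<close>

definition proper_action :: "'g set \<Rightarrow> ('g \<Rightarrow> 'a::metric_space \<Rightarrow> 'a) \<Rightarrow> bool" where
  "proper_action \<Gamma> \<rho> \<longleftrightarrow> (\<forall>x. \<exists>r>0. finite {\<gamma> \<in> \<Gamma>. dist x (\<rho> \<gamma> x) < r})"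

definition cocompact_action :: "'g set \<Rightarrow> ('g \<Rightarrow> 'a::metric_space \<Rightarrow> 'a) \<Rightarrow> bool" where
  "cocompact_action \<Gamma> \<rho> \<longleftrightarrow> (\<exists>K. compact K \<and> (\<Union>\<gamma>\<in>\<Gamma>. \<rho> \<gamma> ` K) = UNIV)"

text \<open>
  The quotient map onto the set of orbits determines its codomain topology \<open>Q\<close>
  uniquely, so this says that the orbit space with the quotient topology is compact.
\<close>

definition compact_quotient :: "'g set \<Rightarrow> ('g \<Rightarrow> 'a::metric_space \<Rightarrow> 'a) \<Rightarrow> bool" where
  "compact_quotient \<Gamma> \<rho> \<longleftrightarrow>
     (\<exists>Q. quotient_map euclidean Q (\<lambda>x. (\<lambda>\<gamma>. \<rho> \<gamma> x) ` \<Gamma>) \<and> compact_space Q)"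

text \<open>
  Crystallographic of rank \<open>n = CARD('n)\<close>.  Discreteness refers to the topology of
  pointwise convergence (the topology of the function type), which on isometry
  groups coincides with the compact-open topology.
\<close>

definition crystallographic :: "'n::finite itself \<Rightarrow> 'g monoid \<Rightarrow> bool" where
  "crystallographic _ G \<longleftrightarrow>
     (\<exists>H :: (real ^ 'n \<Rightarrow> real ^ 'n) set.
        subgroup H isometry_group \<and> discrete H \<and> cocompact_action H (\<lambda>h. h) \<and>
        G \<cong> isometry_group\<lparr>carrier := H\<rparr>)"

definition rough_isometry :: "('a::metric_space \<Rightarrow> 'b::metric_space) \<Rightarrow> bool" where
  "rough_isometry \<phi> \<longleftrightarrow>
     (\<exists>A\<ge>0.
        (\<forall>x x'. dist x x' - A \<le> dist (\<phi> x) (\<phi> x') \<and> dist (\<phi> x) (\<phi> x') \<le> dist x x' + A) \<and>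
        (\<forall>y. \<exists>x. dist y (\<phi> x) \<le> A))"

end

theory Submission
  imports Defs
begin

text \<open>
  In a geodesic Ptolemy space the distance to a point is convex. Crystallographic groups contain,
  with finite index, a lattice of translations; along it put \<open>D v = dist x0 (v x0)\<close>. If \<open>m\<close> is the
  midpoint of \<open>x0\<close> and \<open>(2 v) x0\<close>, convexity at \<open>m\<close>, summed over a large piece of the lattice,
  shows that \<open>m\<close> stays within bounded distance of \<open>v x0\<close>. Hence \<open>D (2 v) = 2 D v + O(1)\<close>, so \<open>D\<close> is
  within bounded distance of a norm. This norm inherits the Ptolemy inequality and is therefore
  Euclidean: in coordinates where the Euclidean norm dominates it with least energy, the cone
  where the two agree is closed under bisecting angles, hence a subspace, and by minimality it is
  everything. Averaging orbit points with weights gives a continuous equivariant map, which is a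
  rough isometry for the new Euclidean structure.
\<close>

text \<open>The isomorphism onto a discrete Euclidean group is purely algebraic, so the Euclidean
  metric that comes with it says nothing about distances in \<open>X\<close>. A Euclidean structure
  has to be read off from \<open>X\<close> itself; a linear change of coordinates then makes the
  given affine action isometric for it. The obstacle is the size of the error. Subadditivity of
  \<open>D\<close> alone controls it from one side only. A rough isometry needs the reverse bound
  \<open>2 * D v \<le> D (2 *\<^sub>R v) + B\<close> with \<open>B\<close> independent of
  \<open>v\<close>. The midpoint \<open>m\<close> would give it at once if it were known to lie near
  the orbit point of \<open>v\<close>, but a priori it could drift away as \<open>v\<close> grows.
  One instance of convexity does not exclude this, which is why the inequality is summed over many
  viewpoints. Under conjugation by a group element \<open>D\<close> changes by a constant that
  depends on the element. Such constants vanish in the limit, so the norm is exactly invariant under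
  all linear parts, and the whole group, not just the lattice, acts by isometries of the new
  structure.\<close>

unbundle no m_inv_syntax

section \<open>Groups of isometries\<close>

locale isometry_action_group =
  fixes G :: "('a::metric_space \<Rightarrow> 'a) set"
  assumes dist_eq: "g \<in> G \<Longrightarrow> dist (g x) (g y) = dist x y"
    and bij: "g \<in> G \<Longrightarrow> bij g"
    and id_mem: "id \<in> G"
    and comp_mem: "\<lbrakk>g \<in> G; h \<in> G\<rbrakk> \<Longrightarrow> g \<circ> h \<in> G"
    and inv_mem: "g \<in> G \<Longrightarrow> inv g \<in> G"
begin


lemma inv_right: "g \<in> G \<Longrightarrow> g (inv g x) = x"
  by (simp add: bij bij_is_surj surj_f_inv_f)

lemma inv_left [simp]: "g \<in> G \<Longrightarrow> inv g (g x) = x"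
  by (simp add: bij bij_is_inj)

lemma dist_inv: "g \<in> G \<Longrightarrow> dist (inv g x) y = dist x (g y)"
  using dist_eq[of g "inv g x" y] by (simp add: inv_right)

end

lemma isometry_action_group_of_subgroup:
  assumes "subgroup G isometry_group"
  shows "isometry_action_group G"
proof
  have sub: "G \<subseteq> carrier isometry_group"
    using assms by (simp add: subgroup_def)
  fix g assume g: "g \<in> G"
  show "dist (g x) (g y) = dist x y" for x y
    using sub g by (auto simp: isometry_group_def)
  show bij: "bij g"
    using sub g by (auto simp: isometry_group_def)
  have "m_inv isometry_group g = inv g"
  proof (rule group.inv_equality[OF group_isometry_group])
    show "inv g \<otimes>\<^bsub>isometry_group\<^esub> g = \<one>\<^bsub>isometry_group\<^esub>"
      using bij by (simp add: isometry_group_def bij_is_inj)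
    show "g \<in> carrier isometry_group" using sub g by auto
    have "dist (inv g x) (inv g y) = dist x y" for x y
      using \<open>\<And>x y. dist (g x) (g y) = dist x y\<close>[of "inv g x" "inv g y"] bij
      by (simp add: bij_is_surj surj_f_inv_f)
    then show "inv g \<in> carrier isometry_group"
      using bij by (simp add: isometry_group_def bij_imp_bij_inv)
  qed
  then show "inv g \<in> G"
    using subgroup.m_inv_closed[OF assms g] by simp
next
  show "id \<in> G"
    using subgroup.one_closed[OF assms] by (simp add: isometry_group_def)
  show "g \<circ> h \<in> G" if "g \<in> G" "h \<in> G" for g h
    using subgroup.m_closed[OF assms that] by (simp add: isometry_group_def)
qed

text \<open>Bundled as a bounded operator so that the operator norm and convergent subsequences of
  linear parts are available. It is meaningful for isometries, where \<open>g x - g 0\<close> is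
  linear in \<open>x\<close>.\<close>

definition lin :: "('v::euclidean_space \<Rightarrow> 'v) \<Rightarrow> 'v \<Rightarrow>\<^sub>L 'v" where
  "lin g = Blinfun (\<lambda>x. g x - g 0)"

locale euclidean_isometry_group = isometry_action_group G
  for G :: "('v::euclidean_space \<Rightarrow> 'v) set"
begin


lemma lin_apply: "g \<in> G \<Longrightarrow> lin g x = g x - g 0"
proof -
  assume g: "g \<in> G"
  have "dist (g x - g 0) (g y - g 0) = dist x y" for x y
    using dist_eq[OF g, of x y] by (simp add: dist_norm)
  then have "linear (\<lambda>x. g x - g 0)"
    by (intro isometry_linear) auto
  then show ?thesis
    unfolding lin_def by (subst bounded_linear_Blinfun_apply) (auto simp: linear_conv_bounded_linear)
qed

lemma affine: "g \<in> G \<Longrightarrow> g x = lin g x + g 0"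
  by (simp add: lin_apply)

lemma norm_lin [simp]: "g \<in> G \<Longrightarrow> norm (lin g x) = norm x"
  using dist_eq[of g x 0] by (simp add: lin_apply dist_norm)

lemma lin_comp [simp]: "\<lbrakk>g \<in> G; h \<in> G\<rbrakk> \<Longrightarrow> lin (g \<circ> h) x = lin g (lin h x)"
proof -
  assume gh: "g \<in> G" "h \<in> G"
  have "lin (g \<circ> h) x = g (h x) - g (h 0)"
    using lin_apply[OF comp_mem[OF gh]] by simp
  also have "\<dots> = lin g (h x) - lin g (h 0)"
    by (simp add: lin_apply[OF gh(1)])
  also have "\<dots> = lin g (h x - h 0)"
    by (simp only: blinfun.diff_right)
  finally show ?thesis
    by (simp add: lin_apply[OF gh(2)])
qed

lemma lin_inv_right [simp]: "g \<in> G \<Longrightarrow> lin g (lin (inv g) x) = x"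
  using lin_comp[of g "inv g" x] lin_apply[OF id_mem, of x]
  by (simp add: inv_mem bij bij_is_surj surj_iff[THEN iffD1] del: lin_comp)

lemma lin_inv_left [simp]: "g \<in> G \<Longrightarrow> lin (inv g) (lin g x) = x"
  using lin_comp[of "inv g" g x] lin_apply[OF id_mem, of x]
  by (simp add: inv_mem bij bij_is_inj del: lin_comp)

text \<open>Among the elements of \<open>G\<close> the value 0 singles out the translations; they
  will be found by showing that small values are 0.\<close>

definition rot :: "('v \<Rightarrow> 'v) \<Rightarrow> real" where
  "rot g = norm (lin g - id_blinfun)"

lemma rot_nonneg [simp]: "rot g \<ge> 0"
  by (simp add: rot_def)

lemma rot_le: "norm (lin g x - x) \<le> rot g * norm x"
  using norm_blinfun[of "lin g - id_blinfun" x] by (simp add: rot_def blinfun.diff_left)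

lemma rot_bound:
  assumes "c \<ge> 0" "\<And>x. norm (lin g x - x) \<le> c * norm x"
  shows "rot g \<le> c"
  unfolding rot_def by (rule norm_blinfun_bound) (use assms in \<open>auto simp: blinfun.diff_left\<close>)

text \<open>Composing with the orthogonal map \<open>lin (inv h)\<close> preserves the operator
  norm. Hence elements with close linear parts have a quotient of small rotation.\<close>

lemma rot_comp_inv:
  assumes "g \<in> G" "h \<in> G"
  shows "rot (g \<circ> inv h) = norm (lin g - lin h)"
proof (rule antisym)
  show "rot (g \<circ> inv h) \<le> norm (lin g - lin h)"
  proof (rule rot_bound)
    fix x
    have "norm (lin (g \<circ> inv h) x - x) = norm ((lin g - lin h) (lin (inv h) x))"
      using assms by (simp add: inv_mem blinfun.diff_left)
    also have "\<dots> \<le> norm (lin g - lin h) * norm (lin (inv h) x)"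
      by (rule norm_blinfun)
    finally show "norm (lin (g \<circ> inv h) x - x) \<le> norm (lin g - lin h) * norm x"
      using assms by (simp add: inv_mem)
  qed simp
  show "norm (lin g - lin h) \<le> rot (g \<circ> inv h)"
  proof (rule norm_blinfun_bound)
    fix x
    show "norm ((lin g - lin h) x) \<le> rot (g \<circ> inv h) * norm x"
      using rot_le[of "g \<circ> inv h" "lin h x"] assms by (simp add: inv_mem blinfun.diff_left)
  qed simp
qed

lemma translation_if_rot_0: "rot g = 0 \<Longrightarrow> g \<in> G \<Longrightarrow> g = (+) (g 0)"
proof
  fix x
  assume "rot g = 0" "g \<in> G"
  then show "g x = g 0 + x"
    using rot_le[of g x] affine[of g x] by simp
qed

text \<open>Log-convexity of the powers of a normal operator.\<close>

lemma norm_power2_le_normal: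
  assumes "g \<in> G"
  defines "M \<equiv> \<lambda>x. lin g x - x"
  shows "(norm (M x))\<^sup>2 \<le> norm (M (M x)) * norm x"
proof -
  have inner_lin: "lin g y \<bullet> z = y \<bullet> lin (inv g) z" for y z
  proof -
    have "lin g y \<bullet> lin g w = y \<bullet> w" for w
      using norm_lin[OF assms(1)] by (simp add: dot_norm blinfun.add_right[symmetric])
    from this[of "lin (inv g) z"] show ?thesis using assms(1) by simp
  qed
  have "(norm (M x))\<^sup>2 = lin g x \<bullet> M x - x \<bullet> M x"
    by (simp add: M_def power2_norm_eq_inner inner_diff_left)
  also have "\<dots> = x \<bullet> (lin (inv g) (M x) - M x)"
    by (simp add: inner_lin inner_diff_right)
  also have "\<dots> \<le> norm x * norm (lin (inv g) (M x) - M x)"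
    by (rule norm_cauchy_schwarz)
  \<comment> \<open>The adjoint of \<open>M\<close> is \<open>- M\<close> followed by the isometry
    \<open>lin (inv g)\<close>, so both have the same norm at \<open>M x\<close>.\<close>
  also have "norm (lin (inv g) (M x) - M x) = norm (lin g (lin (inv g) (M x) - M x))"
    using assms(1) by simp
  also have "\<dots> = norm (M (M x))"
    using assms(1) by (subst blinfun.diff_right) (simp add: M_def norm_minus_commute)
  finally show ?thesis by (simp add: mult.commute)
qed

section \<open>Commutators of Euclidean isometries\<close>

definition commutator :: "('v \<Rightarrow> 'v) \<Rightarrow> ('v \<Rightarrow> 'v) \<Rightarrow> 'v \<Rightarrow> 'v" where
  "commutator g h = g \<circ> h \<circ> inv g \<circ> inv h"

lemma commutator_mem: "g \<in> G \<Longrightarrow> h \<in> G \<Longrightarrow> commutator g h \<in> G"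
  by (simp add: commutator_def comp_mem inv_mem)

text \<open>The identity commutes with everything, so only the deviations of the two linear parts
  from it enter, and they enter as a product.\<close>

lemma norm_lin_commute:
  assumes "g \<in> G" "h \<in> G"
  shows "norm (lin g (lin h y) - lin h (lin g y)) \<le> 2 * rot g * rot h * norm y"
proof -
  let ?M = "\<lambda>x. lin g x - x" and ?L = "\<lambda>x. lin h x - x"
  have "lin g (lin h y) - lin h (lin g y) = ?M (?L y) - ?L (?M y)"
    by (simp add: blinfun.diff_right)
  then have "norm (lin g (lin h y) - lin h (lin g y)) \<le> norm (?M (?L y)) + norm (?L (?M y))"
    by (metis norm_triangle_ineq4)
  also have "\<dots> \<le> rot g * norm (?L y) + rot h * norm (?M y)"
    by (intro add_mono rot_le)
  also have "\<dots> \<le> rot g * (rot h * norm y) + rot h * (rot g * norm y)"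
    by (intro add_mono mult_left_mono rot_le) auto
  finally show ?thesis by (simp add: algebra_simps)
qed

lemma rot_commutator:
  assumes "g \<in> G" "h \<in> G"
  shows "rot (commutator g h) \<le> 2 * rot g * rot h"
proof (rule rot_bound)
  fix x
  define y where "y = lin (inv g) (lin (inv h) x)"
  have "lin h (lin g y) = x" "norm y = norm x"
    using assms by (auto simp: y_def inv_mem)
  moreover have "lin (commutator g h) x = lin g (lin h y)"
    using assms by (simp add: commutator_def y_def inv_mem comp_mem)
  ultimately show "norm (lin (commutator g h) x - x) \<le> 2 * rot g * rot h * norm x"
    using norm_lin_commute[OF assms, of y] by simp
qed simp

text \<open>To leading order, forming the commutator with \<open>g\<close> applies
  \<open>lin g - 1\<close> to the displacement of \<open>h\<close>. Every error term carries the
  factor \<open>rot h\<close>, so the formula is exact when \<open>h\<close> is a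
  translation.\<close>

lemma commutator_origin:
  assumes "g \<in> G" "h \<in> G"
  shows "norm (commutator g h 0 - (lin g (h 0) - h 0))
    \<le> 2 * rot g * rot h * (norm (g 0) + norm (h 0)) + rot h * norm (g 0)"
proof -
  define y where "y = inv g (inv h 0)"
  have hg: "h (g y) = 0" and c: "commutator g h 0 = g (h y)"
    using assms by (auto simp: y_def commutator_def inv_mem inv_right)
  have 1: "lin h (lin g y) + lin h (g 0) + h 0 = 0"
    using hg affine[OF assms(1), of y] affine[OF assms(2), of "g y"] by (simp add: blinfun.add_right)
  have 2: "g (h y) = lin g (lin h y) + lin g (h 0) + g 0"
    using affine[OF assms(2), of y] affine[OF assms(1), of "h y"] by (simp add: blinfun.add_right)
  have "norm y = norm (lin h (lin g y))" using assms by simp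
  also have "lin h (lin g y) = - (lin h (g 0) + h 0)"
    using 1 by (subst eq_neg_iff_add_eq_0) (simp only: add.assoc)
  finally have "norm y = norm (lin h (g 0) + h 0)" by (simp only: norm_minus_cancel)
  then have y: "norm y \<le> norm (g 0) + norm (h 0)"
    using norm_triangle_ineq[of "lin h (g 0)" "h 0"] assms by simp
  have "commutator g h 0 - (lin g (h 0) - h 0)
      = (lin g (lin h y) - lin h (lin g y)) - (lin h (g 0) - g 0)"
  proof -
    have "lin h (lin g y) = - (lin h (g 0) + h 0)"
      using 1 by (subst eq_neg_iff_add_eq_0) (simp only: add.assoc)
    then show ?thesis by (simp add: c 2)
  qed
  then have "norm (commutator g h 0 - (lin g (h 0) - h 0))
      \<le> norm (lin g (lin h y) - lin h (lin g y)) + norm (lin h (g 0) - g 0)"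
    by (metis norm_triangle_ineq4)
  also have "\<dots> \<le> 2 * rot g * rot h * norm y + rot h * norm (g 0)"
    by (intro add_mono norm_lin_commute rot_le assms)
  also have "\<dots> \<le> 2 * rot g * rot h * (norm (g 0) + norm (h 0)) + rot h * norm (g 0)"
    using y by (intro add_mono mult_left_mono) auto
  finally show ?thesis .
qed

end

section \<open>Bieberbach's first theorem\<close>

locale crystallographic_group = euclidean_isometry_group +
  assumes discrete: "discrete G"
    and cobounded: "\<exists>R. \<forall>x. \<exists>g\<in>G. norm (x - g 0) \<le> R"
begin

text \<open>The function type carries the topology of pointwise convergence, so an open set
  isolating \<open>id\<close> in \<open>G\<close> catches every sequence tending pointwise to
  \<open>id\<close>.\<close>

lemma eventually_id:
  fixes f :: "nat \<Rightarrow> 'a \<Rightarrow> 'a"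
  assumes f: "\<And>n. f n \<in> G" and lim: "\<And>x. (\<lambda>n. f n x) \<longlonglongrightarrow> x"
  shows "eventually (\<lambda>n. f n = id) sequentially"
proof -
  obtain U where U: "open U" "U \<inter> G = {id}"
    using discreteD[OF discrete id_mem] by (auto simp: isolated_in_def)
  have "limitin (product_topology (\<lambda>_. euclidean) UNIV) f id sequentially"
    using lim by (simp add: limitin_componentwise)
  then have "f \<longlonglongrightarrow> id"
    by (simp add: euclidean_product_topology)
  then have "eventually (\<lambda>n. f n \<in> U) sequentially"
    using U by (intro topological_tendstoD) auto
  then show ?thesis
    by eventually_elim (use f U in auto)
qed

lemma norm_lin_le_1: "g \<in> G \<Longrightarrow> norm (lin g) \<le> 1"
  by (rule norm_blinfun_bound) auto

text \<open>Infinitely many such elements would have a subsequence with convergent linear and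
  translation parts. The limit is not known to lie in \<open>G\<close>, so discreteness is applied
  to quotients of consecutive terms, which tend to \<open>id\<close>.\<close>

lemma finite_bounded: "finite {g \<in> G. norm (g 0) \<le> R}"
proof (rule ccontr)
  assume "\<not> ?thesis"
  then obtain f :: "nat \<Rightarrow> 'a \<Rightarrow> 'a" where f: "inj f" "range f \<subseteq> {g \<in> G. norm (g 0) \<le> R}"
    using infinite_countable_subset by blast
  then have fG: "f n \<in> G" and fR: "norm (f n 0) \<le> R" for n by auto
  have "bounded (range (\<lambda>n. (lin (f n), f n 0)))"
    by (rule bounded_subset[of "cball 0 1 \<times> cball 0 R"])
      (auto intro!: bounded_Times norm_lin_le_1 fG fR)
  then obtain l r where r: "strict_mono (r :: nat \<Rightarrow> nat)"
    and l: "((\<lambda>n. (lin (f n), f n 0)) \<circ> r) \<longlonglongrightarrow> l"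
    using bounded_imp_convergent_subsequence by blast
  have l1: "(\<lambda>n. lin (f (r n))) \<longlonglongrightarrow> fst l" and l2: "(\<lambda>n. f (r n) 0) \<longlonglongrightarrow> snd l"
    using tendsto_fst[OF l] tendsto_snd[OF l] by (auto simp: o_def)
  have lim: "(\<lambda>n. f (r n) x) \<longlonglongrightarrow> fst l x + snd l" for x
    using tendsto_add[OF blinfun.tendsto[OF l1 tendsto_const[of x]] l2]
    by (simp add: affine[OF fG, of _ x, symmetric])
  define g where "g n = inv (f (r n)) \<circ> f (r (Suc n))" for n
  have "eventually (\<lambda>n. g n = id) sequentially"
  proof (rule eventually_id)
    show "g n \<in> G" for n
      by (simp add: g_def comp_mem inv_mem fG)
    fix x
    have "(\<lambda>n. dist (f (r (Suc n)) x) (f (r n) x)) \<longlonglongrightarrow> dist (fst l x + snd l) (fst l x + snd l)"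
      by (intro tendsto_dist lim LIMSEQ_Suc[OF lim])
    moreover have "dist (f (r (Suc n)) x) (f (r n) x) = dist (g n x) x" for n
      by (simp only: g_def comp_apply dist_inv[OF fG])
    ultimately have "(\<lambda>n. dist (g n x) x) \<longlonglongrightarrow> 0"
      by simp
    then show "(\<lambda>n. g n x) \<longlonglongrightarrow> x"
      by (rule tendsto_dist_iff[THEN iffD2])
  qed
  then obtain n where "g n = id"
    by (meson eventually_happens trivial_limit_sequentially)
  then have "inv (f (r n)) (f (r (Suc n)) x) = x" for x
    unfolding g_def by (metis comp_apply id_apply)
  then have "f (r (Suc n)) x = f (r n) x" for x
    using inv_right[OF fG, of "r n" "f (r (Suc n)) x"] by simp
  then have "f (r (Suc n)) = f (r n)" by (rule ext)
  then have "r (Suc n) = r n" using f(1) by (simp only: inj_eq)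
  moreover have "r n < r (Suc n)" using r by (simp add: strict_mono_less)
  ultimately show False by simp
qed

text \<open>Descent on displacements, made possible by \<open>finite_bounded\<close>. Buser's
  argument calls on it twice, with a different property each time.\<close>

lemma minimal_displacement:
  assumes "g \<in> G" "P g"
  obtains h where "h \<in> G" "P h" "\<And>k. k \<in> G \<Longrightarrow> P k \<Longrightarrow> norm (h 0) \<le> norm (k 0)"
proof -
  let ?S = "{h \<in> G. P h \<and> norm (h 0) \<le> norm (g 0)}"
  have "finite ?S"
    by (rule finite_subset[OF _ finite_bounded[of "norm (g 0)"]]) auto
  moreover have "?S \<noteq> {}" using assms by auto
  ultimately have "Min ((\<lambda>h. norm (h 0)) ` ?S) \<in> (\<lambda>h. norm (h 0)) ` ?S"
    by (intro Min_in) auto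
  then obtain h where h: "h \<in> ?S" "Min ((\<lambda>h. norm (h 0)) ` ?S) = norm (h 0)"
    by (rule imageE)
  then have h2: "norm (h 0) \<le> norm (k 0)" if "k \<in> ?S" for k
    unfolding h(2)[symmetric] using that by (intro Min_le finite_imageI \<open>finite ?S\<close> imageI)
  show ?thesis
  proof (rule that[of h])
    fix k assume k: "k \<in> G" "P k"
    show "norm (h 0) \<le> norm (k 0)"
    proof (cases "norm (k 0) \<le> norm (g 0)")
      case True then show ?thesis using h2[of k] k by simp
    next
      case False then show ?thesis using h(1) by simp
    qed
  qed (use h in auto)
qed

text \<open>Pigeonhole: far out in direction \<open>u\<close> two elements have almost the same linear part.\<close>

lemma small_rotation_in_direction:
  assumes "norm u = 1" "\<epsilon> > 0"
  obtains R where "\<And>K. \<exists>k\<ge>K. \<exists>g\<in>G. rot g < \<epsilon> \<and> norm (g 0 - k *\<^sub>R u) \<le> R"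
proof -
  obtain R where "\<And>x. \<exists>g\<in>G. norm (x - g 0) \<le> R" using cobounded by blast
  then have "\<forall>n. \<exists>g. g \<in> G \<and> norm (real n *\<^sub>R u - g 0) \<le> R" by blast
  then obtain f :: "nat \<Rightarrow> 'a \<Rightarrow> 'a"
    where f: "\<And>n. f n \<in> G \<and> norm (real n *\<^sub>R u - f n 0) \<le> R"
    using choice[of "\<lambda>n g. g \<in> G \<and> norm (real n *\<^sub>R u - g 0) \<le> R"] by blast
  then have fG: "f n \<in> G" and fR: "norm (real n *\<^sub>R u - f n 0) \<le> R" for n by auto
  have "bounded (range (\<lambda>n. lin (f n)))"
    by (rule bounded_subset[of "cball 0 1"]) (auto intro!: norm_lin_le_1 fG)
  then obtain l r where r: "strict_mono (r :: nat \<Rightarrow> nat)" and l: "((\<lambda>n. lin (f n)) \<circ> r) \<longlonglongrightarrow> l"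
    using bounded_imp_convergent_subsequence by blast
  have "Cauchy ((\<lambda>n. lin (f n)) \<circ> r)" using l by (rule LIMSEQ_imp_Cauchy)
  then obtain M where M: "\<And>n. n \<ge> M \<Longrightarrow> norm (lin (f (r n)) - lin (f (r M))) < \<epsilon>"
  proof -
    obtain M where "\<forall>m\<ge>M. \<forall>n\<ge>M. dist (lin (f (r m))) (lin (f (r n))) < \<epsilon>"
      using \<open>Cauchy _\<close> assms(2) unfolding Cauchy_def o_def by blast
    then show ?thesis by (intro that[of M]) (simp add: dist_norm)
  qed
  \<comment> \<open>\<open>M\<close> is fixed before \<open>K\<close>, so dividing by
    \<open>f (r M)\<close> adds a constant to the distance from the ray.\<close>
  show ?thesis
  proof (rule that[of "R + norm (f (r M) 0)"])
    fix K :: real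
    define n where "n = max M (nat \<lceil>K\<rceil>)"
    define g where "g = f (r n) \<circ> inv (f (r M))"
    have gG: "g \<in> G" by (simp add: g_def comp_mem inv_mem fG)
    have "K \<le> real n" unfolding n_def by linarith
    also have "\<dots> \<le> real (r n)" using seq_suble[OF r] by simp
    finally have K: "K \<le> real (r n)" .
    have "rot g < \<epsilon>"
      using M[of n] by (simp add: g_def rot_comp_inv fG n_def)
    moreover have "norm (g 0 - real (r n) *\<^sub>R u) \<le> R + norm (f (r M) 0)"
    proof -
      have "g 0 - f (r n) 0 = lin (f (r n)) (inv (f (r M)) 0)"
        by (simp add: g_def lin_apply fG)
      then have "norm (g 0 - f (r n) 0) = norm (inv (f (r M)) 0)"
        by (simp add: fG)
      also have "\<dots> = norm (f (r M) 0)"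
        using dist_inv[OF fG, of "r M" 0 0] by simp
      finally show ?thesis
        using norm_triangle_ineq[of "g 0 - f (r n) 0" "f (r n) 0 - real (r n) *\<^sub>R u"] fR[of "r n"]
        by (simp add: norm_minus_commute)
    qed
    ultimately show "\<exists>k\<ge>K. \<exists>g\<in>G. rot g < \<epsilon> \<and> norm (g 0 - k *\<^sub>R u) \<le> R + norm (f (r M) 0)"
      using K gG by blast
  qed
qed

text \<open>
  Buser's argument: for a non-translation \<open>a\<close> of minimal displacement, commutators with \<open>a\<close>
  shorten displacement vectors that \<open>a\<close> rotates nearly as much as possible, without ever
  killing them; the invariant \<open>P\<close> is what makes this go on forever.
\<close>

lemma translation_if_small_rotation:
  assumes "g \<in> G" "rot g \<le> 1 / 4"
  shows "rot g = 0"
proof (rule ccontr)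
  assume "rot g \<noteq> 0"
  then have g: "0 < rot g \<and> rot g \<le> 1 / 4" using assms by (simp add: less_le)
  obtain a where a: "a \<in> G" "0 < rot a" "rot a \<le> 1 / 4"
    and a_min: "\<And>k. k \<in> G \<Longrightarrow> 0 < rot k \<and> rot k \<le> 1/4 \<Longrightarrow> norm (a 0) \<le> norm (k 0)"
    by (rule minimal_displacement[OF assms(1), of "\<lambda>g. 0 < rot g \<and> rot g \<le> 1/4", OF g]) blast
  define m where "m = rot a"
  define M where "M x = lin a x - x" for x
  have M_le: "norm (M x) \<le> m * norm x" for x
    unfolding M_def m_def by (rule rot_le)
  have M_add: "M (x + y) = M x + M y" for x y
    by (simp add: M_def blinfun.add_right)
  \<comment> \<open>The reserve \<open>16 * rot b\<close> pays for the errors of the next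
    commutator. Passing to it halves \<open>rot b\<close> at least and so releases
    \<open>8 * rot b\<close>; as \<open>norm (M (b 0))\<close> is at least
    \<open>m / 2 * norm (b 0)\<close>, this covers \<open>2 * m\<close> times the error bound
    \<open>2 * rot b * norm (b 0)\<close> found below.\<close>
  define P where "P b \<longleftrightarrow> b 0 \<noteq> 0 \<and> (m / 2 + 16 * rot b) * norm (b 0) \<le> norm (M (b 0))" for b
  have m: "0 < m" "m \<le> 1/4" using a by (auto simp: m_def)
  \<comment> \<open>A direction that \<open>a\<close> moves nearly as much as the operator norm
    allows. The factor \<open>3 / 4\<close> leaves room above the \<open>5 / 8\<close> that
    \<open>P\<close> will demand: \<open>1 / 2\<close> plus \<open>16 / 128\<close>.\<close>
  obtain u where u: "norm u = 1" "3 / 4 * m \<le> norm (M u)"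
  proof -
    have "\<exists>x. 3 / 4 * m * norm x < norm (M x)"
    proof (rule ccontr)
      assume "\<nexists>x. 3 / 4 * m * norm x < norm (M x)"
      then have "rot a \<le> 3 / 4 * m"
        using m by (intro rot_bound) (auto simp: M_def not_less)
      then show False using m by (simp add: m_def)
    qed
    then obtain x where x: "3 / 4 * m * norm x < norm (M x)" by blast
    then have "x \<noteq> 0" using M_le[of 0] by auto
    moreover have "M (x /\<^sub>R norm x) = M x /\<^sub>R norm x"
      by (simp add: M_def blinfun.scaleR_right algebra_simps)
    ultimately show ?thesis
      using x by (intro that[of "x /\<^sub>R norm x"]) (auto simp: field_simps)
  qed
  obtain R where R: "\<And>K. \<exists>k\<ge>K. \<exists>g\<in>G. rot g < m / 128 \<and> norm (g 0 - k *\<^sub>R u) \<le> R"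
    using small_rotation_in_direction[OF u(1), of "m / 128"] m by auto
  have "R \<ge> 0" using R[of 0] norm_ge_zero order_trans by blast
  \<comment> \<open>The surplus \<open>3 / 4 - 5 / 8 = 1 / 8\<close> must absorb an error of
    \<open>13 / 8 * m * R\<close>, hence \<open>13 * R\<close>; the added 1 keeps \<open>b 0\<close>
    away from 0.\<close>
  obtain k b where k: "k \<ge> 13 * R + 1" and b: "b \<in> G" "rot b < m / 128" "norm (b 0 - k *\<^sub>R u) \<le> R"
    using R[of "13 * R + 1"] by blast
  have "P b"
  proof -
    have kp: "k > 0" using k \<open>R \<ge> 0\<close> by simp
    have "M (b 0) = k *\<^sub>R M u + M (b 0 - k *\<^sub>R u)"
      by (simp add: M_def blinfun.scaleR_right blinfun.diff_right algebra_simps)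
    then have "norm (M (b 0)) \<ge> norm (k *\<^sub>R M u) - norm (M (b 0 - k *\<^sub>R u))"
      by (simp only: norm_diff_ineq)
    moreover have "norm (M (b 0 - k *\<^sub>R u)) \<le> m * R"
      using M_le[of "b 0 - k *\<^sub>R u"] mult_left_mono[OF b(3), of m] m by linarith
    moreover have "norm (k *\<^sub>R M u) \<ge> k * (3 / 4 * m)"
      using u kp by simp
    ultimately have 1: "norm (M (b 0)) \<ge> k * (3 / 4 * m) - m * R" by linarith
    have 2: "norm (b 0) \<le> k + R" "norm (b 0) \<ge> k - R"
      using norm_triangle_ineq2[of "b 0" "k *\<^sub>R u"] norm_triangle_ineq2[of "k *\<^sub>R u" "b 0"] u kp b(3)
      by (auto simp: norm_minus_commute)
    have "(m / 2 + 16 * rot b) * norm (b 0) \<le> (5 / 8 * m) * (k + R)"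
      using b 2 m by (intro mult_mono) auto
    also have "\<dots> = 5 / 8 * m * k + 5 / 8 * m * R" by (simp add: algebra_simps)
    also have "\<dots> \<le> k * (3 / 4 * m) - m * R"
    proof -
      have "m * (13 * R) \<le> m * k" using k m by (intro mult_left_mono) auto
      then show ?thesis by (simp add: algebra_simps)
    qed
    finally show ?thesis using 1 2 k \<open>R \<ge> 0\<close> by (auto simp: P_def)
  qed
  \<comment> \<open>From here on \<open>b\<close> is shortest with property \<open>P\<close>. Its
    commutator with \<open>a\<close> will satisfy \<open>P\<close> as well and be strictly
    shorter.\<close>
  then obtain b where b: "b \<in> G" "P b" and b_min: "\<And>k. k \<in> G \<Longrightarrow> P k \<Longrightarrow> norm (b 0) \<le> norm (k 0)"
    by (rule minimal_displacement[OF b(1), of P]) blast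
  define B where "B = norm (b 0)"
  define \<beta> where "\<beta> = rot b"
  define \<mu> where "\<mu> = m / 2 + 16 * \<beta>"
  have B: "B > 0" and b\<mu>: "\<mu> * B \<le> norm (M (b 0))"
    using b(2) by (auto simp: P_def B_def \<beta>_def \<mu>_def)
  have "\<mu> * B \<le> m * B" using b\<mu> M_le[of "b 0"] by (simp add: B_def)
  then have \<mu>: "\<mu> \<le> m" using B by simp
  have \<beta>: "\<beta> \<ge> 0" "\<beta> \<le> m / 32" using \<mu> by (auto simp: \<beta>_def \<mu>_def)
  define c where "c = commutator a b"
  define r where "r = c 0 - M (b 0)"
  have cG: "c \<in> G" unfolding c_def by (intro commutator_mem a b)
  have rot_c: "rot c \<le> \<beta> / 2"
  proof -
    have "rot c \<le> 2 * m * \<beta>" unfolding c_def m_def \<beta>_def by (rule rot_commutator[OF a(1) b(1)])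
    also have "\<dots> \<le> 2 * (1/4) * \<beta>" using m \<beta> by (intro mult_right_mono mult_left_mono) auto
    finally show ?thesis by simp
  qed
  have r: "norm r \<le> 2 * \<beta> * B"
  proof -
    have *: "norm r \<le> 2 * m * \<beta> * (norm (a 0) + B) + \<beta> * norm (a 0)"
      unfolding r_def c_def m_def \<beta>_def B_def M_def by (rule commutator_origin[OF a(1) b(1)])
    \<comment> \<open>If \<open>b\<close> rotates, it competes with \<open>a\<close> for minimality,
      so \<open>a\<close> is no longer than \<open>b\<close>. If it does not, \<open>a\<close> may
      be long, but the error has the factor \<beta> and vanishes.\<close>
    show ?thesis
    proof (cases "\<beta> = 0")
      case True then show ?thesis using * by simp
    next
      case False
      then have "norm (a 0) \<le> B"
        unfolding B_def using \<beta> m by (intro a_min b(1)) (simp add: \<beta>_def less_le)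
      then have "2 * m * \<beta> * (norm (a 0) + B) + \<beta> * norm (a 0) \<le> 2 * (1/4) * \<beta> * (B + B) + \<beta> * B"
        using m \<beta> B by (intro add_mono mult_mono) (auto intro: add_nonneg_nonneg)
      then show ?thesis using * by (simp add: mult.commute mult.left_commute)
    qed
  qed
  have c0: "c 0 = M (b 0) + r" by (simp add: r_def)
  have c_le: "norm (c 0) \<le> norm (M (b 0)) + norm r" and c_ge: "norm (c 0) \<ge> norm (M (b 0)) - norm r"
    unfolding c0 by (auto intro: norm_triangle_ineq norm_diff_ineq)
  have "P c"
    unfolding P_def
  proof
    have "norm (c 0) \<ge> (m / 2 + 14 * \<beta>) * B"
      using c_ge r b\<mu> by (simp add: \<mu>_def algebra_simps)
    moreover have "(m / 2 + 14 * \<beta>) * B > 0" using m \<beta> B by (intro mult_pos_pos) auto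
    ultimately show "c 0 \<noteq> 0" by auto
    \<comment> \<open>By log-convexity the ratio of \<open>norm (M x)\<close> to
      \<open>norm x\<close> does not drop when \<open>x\<close> is replaced by \<open>M x\<close>;
      so the lower bound \<mu> survives one application of \<open>M\<close>.\<close>
    have "\<mu> * B * norm (M (b 0)) \<le> (norm (M (b 0)))\<^sup>2"
      using b\<mu> by (simp add: power2_eq_square mult_right_mono)
    also have "\<dots> \<le> norm (M (M (b 0))) * B"
      using norm_power2_le_normal[OF a(1), of "b 0"] by (simp add: M_def B_def)
    finally have "B * (\<mu> * norm (M (b 0))) \<le> B * norm (M (M (b 0)))"
      by (simp add: algebra_simps)
    then have M2: "\<mu> * norm (M (b 0)) \<le> norm (M (M (b 0)))" using B by simp
    have "M (c 0) = M (M (b 0)) + M r"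
      by (simp add: c0 M_add)
    then have "norm (M (c 0)) \<ge> norm (M (M (b 0))) - norm (M r)"
      by (simp only: norm_diff_ineq)
    with M2 M_le[of r] have 1: "norm (M (c 0)) \<ge> \<mu> * norm (M (b 0)) - m * norm r" by linarith
    have "(m / 2 + 16 * rot c) * norm (c 0) \<le> (\<mu> - 8 * \<beta>) * (norm (M (b 0)) + norm r)"
      using c_le rot_c m \<beta> by (intro mult_mono) (auto simp: \<mu>_def)
    also have "\<dots> = \<mu> * norm (M (b 0)) - 8 * \<beta> * norm (M (b 0)) + (\<mu> - 8 * \<beta>) * norm r"
      by (simp add: algebra_simps)
    also have "\<dots> \<le> \<mu> * norm (M (b 0)) - 4 * m * \<beta> * B + m * norm r"
    proof -
      have "8 * \<beta> * (m / 2 * B) \<le> 8 * \<beta> * norm (M (b 0))"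
      proof (rule mult_left_mono)
        have "m / 2 * B \<le> \<mu> * B" using \<beta> B by (intro mult_right_mono) (auto simp: \<mu>_def)
        then show "m / 2 * B \<le> norm (M (b 0))" using b\<mu> by linarith
      qed (use \<beta> in auto)
      moreover have "(\<mu> - 8 * \<beta>) * norm r \<le> m * norm r"
        using \<mu> \<beta> by (intro mult_right_mono) auto
      ultimately show ?thesis by (simp add: algebra_simps)
    qed
    also have "\<dots> \<le> \<mu> * norm (M (b 0)) - m * norm r"
      using mult_left_mono[OF r, of "2 * m"] m by (simp add: algebra_simps)
    also note 1
    finally show "(m / 2 + 16 * rot c) * norm (c 0) \<le> norm (M (c 0))" .
  qed
  then have "B \<le> norm (c 0)" unfolding B_def by (intro b_min cG)
  also have "\<dots> \<le> m * B + 2 * \<beta> * B"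
    using c_le r M_le[of "b 0"] by (simp add: B_def)
  also have "\<dots> = (m + 2 * \<beta>) * B" by (simp add: algebra_simps)
  also have "\<dots> < 1 * B" using m \<beta> B by (intro mult_strict_right_mono) auto
  finally show False by simp
qed

section \<open>The lattice of translations and its finite index\<close>

definition translation_lattice :: "'a set" where
  "translation_lattice = {v. (+) v \<in> G}"

text \<open>Linear parts lie in a compact set, covered by finitely many balls of radius
  \<open>1 / 4\<close> around linear parts of elements. Two elements in the same ball differ by a
  rotation below the threshold of \<open>translation_if_small_rotation\<close>, hence by a
  translation.\<close>

lemma finite_index:
  obtains F where "finite F" "F \<subseteq> G"
    "\<And>g. g \<in> G \<Longrightarrow> \<exists>f\<in>F. \<exists>v\<in>translation_lattice. g = (+) v \<circ> f"
proof -
  have "bounded (lin ` G)"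
    by (rule bounded_subset[of "cball 0 1"]) (auto intro!: norm_lin_le_1)
  then have "compact (closure (lin ` G))" by simp
  moreover have "closure (lin ` G) \<subseteq> (\<Union>f\<in>G. ball (lin f) (1 / 4))"
  proof
    fix x assume "x \<in> closure (lin ` G)"
    then have "\<exists>y\<in>lin ` G. dist y x < 1 / 4"
      unfolding closure_approachable by (rule allE[of _ "1 / 4"]) simp
    then show "x \<in> (\<Union>f\<in>G. ball (lin f) (1 / 4))" by auto
  qed
  ultimately obtain F where F: "F \<subseteq> G" "finite F" "closure (lin ` G) \<subseteq> (\<Union>f\<in>F. ball (lin f) (1 / 4))"
    using compactE_image[of "closure (lin ` G)" G "\<lambda>f. ball (lin f) (1 / 4)"] by (metis open_ball)
  show ?thesis
  proof (rule that[OF F(2,1)])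
    fix g assume g: "g \<in> G"
    then have "lin g \<in> closure (lin ` G)" by (intro subsetD[OF closure_subset] imageI)
    then obtain f where f: "f \<in> F" "dist (lin f) (lin g) < 1 / 4" using F(3) by auto
    define t where "t = g \<circ> inv f"
    have fG: "f \<in> G" using f F by auto
    have tG: "t \<in> G" by (simp add: t_def comp_mem inv_mem g fG)
    have "rot t \<le> 1 / 4"
      using f(2) by (simp add: t_def rot_comp_inv g fG dist_norm norm_minus_commute)
    then have t: "t = (+) (t 0)"
      by (intro translation_if_rot_0 translation_if_small_rotation tG)
    have "g = t \<circ> f" using fG by (auto simp: t_def fun_eq_iff)
    moreover have "t 0 \<in> translation_lattice" using t tG by (simp add: translation_lattice_def)
    ultimately show "\<exists>f\<in>F. \<exists>v\<in>translation_lattice. g = (+) v \<circ> f" using t f(1) by (intro bexI[of _ f] bexI[of _ "t 0"]) auto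
  qed
qed

lemma translation_lattice_cobounded: "\<exists>R. \<forall>x. \<exists>v\<in>translation_lattice. norm (x - v) \<le> R"
proof -
  obtain R where R: "\<And>x. \<exists>g\<in>G. norm (x - g 0) \<le> R" using cobounded by blast
  obtain F where F: "finite F" "\<And>g. g \<in> G \<Longrightarrow> \<exists>f\<in>F. \<exists>v\<in>translation_lattice. g = (+) v \<circ> f"
    using finite_index by metis
  have "\<exists>v\<in>translation_lattice. norm (x - v) \<le> R + (\<Sum>f\<in>F. norm (f 0))" for x
  proof -
    obtain g where g: "g \<in> G" "norm (x - g 0) \<le> R" using R by blast
    then obtain f v where f: "f \<in> F" "v \<in> translation_lattice" "g = (+) v \<circ> f" using F(2) by blast
    have "norm (x - v) \<le> norm (x - g 0) + norm (f 0)"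
      using norm_triangle_ineq[of "x - g 0" "f 0"] f(3) by simp
    also have "norm (f 0) \<le> (\<Sum>f\<in>F. norm (f 0))"
      using F(1) f(1) by (intro member_le_sum) auto
    finally show ?thesis using f(2) g(2) by force
  qed
  then show ?thesis by blast
qed

lemma translation_lattice_0: "0 \<in> translation_lattice"
proof -
  have "(+) 0 = (id :: 'a \<Rightarrow> 'a)" by auto
  then show ?thesis using id_mem by (simp add: translation_lattice_def)
qed

lemma translation_lattice_add: "\<lbrakk>v \<in> translation_lattice; w \<in> translation_lattice\<rbrakk> \<Longrightarrow> v + w \<in> translation_lattice"
  using comp_mem[of "(+) v" "(+) w"] by (simp add: translation_lattice_def o_def add.assoc[symmetric])

lemma inv_translation: "inv ((+) v) = (+) (- v)" for v :: 'a
  by (rule inv_unique_comp) (auto simp: fun_eq_iff)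

lemma translation_lattice_uminus: "v \<in> translation_lattice \<Longrightarrow> - v \<in> translation_lattice"
  using inv_mem[of "(+) v"] by (simp add: translation_lattice_def inv_translation)

lemma conjugate_translation:
  assumes "g \<in> G"
  shows "g \<circ> (+) v \<circ> inv g = (+) (lin g v)"
proof
  fix x
  have "g (v + inv g x) = lin g v + (lin g (inv g x) + g 0)"
    using affine[OF assms, of "v + inv g x"] by (simp add: blinfun.add_right)
  also have "lin g (inv g x) + g 0 = x"
    using affine[OF assms, of "inv g x"] inv_right[OF assms] by simp
  finally show "(g \<circ> (+) v \<circ> inv g) x = lin g v + x" by simp
qed

lemma translation_lattice_lin: "\<lbrakk>g \<in> G; v \<in> translation_lattice\<rbrakk> \<Longrightarrow> lin g v \<in> translation_lattice"
  using comp_mem[OF comp_mem[of g "(+) v"] inv_mem[of g]]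
  by (simp add: translation_lattice_def conjugate_translation)

end

section \<open>Ptolemaic norms are Euclidean\<close>

text \<open>\<open>N_ptolemy\<close> is the Ptolemy inequality for the parallelogram with vertices
  \<open>0\<close>, \<open>x\<close>, \<open>x + y\<close>, \<open>y\<close>, whose opposite sides
  agree.\<close>

locale ptolemaic_norm =
  fixes N :: "'v::euclidean_space \<Rightarrow> real"
  assumes N_scale: "N (c *\<^sub>R x) = \<bar>c\<bar> * N x"
    and N_triangle: "N (x + y) \<le> N x + N y"
    and N_definite: "N x \<le> 0 \<Longrightarrow> x = 0"
    and N_ptolemy: "N (x + y) * N (x - y) \<le> (N x)\<^sup>2 + (N y)\<^sup>2"
begin

lemma N_0 [simp]: "N 0 = 0"
  using N_scale[of 0 0] by simp

lemma N_nonneg [simp]: "N x \<ge> 0"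
  using N_definite[of x] by (cases "N x \<le> 0") auto

lemma N_bounded: obtains c where "c > 0" "\<And>x. N x \<le> c * norm x"
proof -
  have N_sum: "finite A \<Longrightarrow> N (\<Sum>b\<in>A. f b) \<le> (\<Sum>b\<in>A. N (f b))" for A and f :: "'v \<Rightarrow> 'v"
    by (induction rule: finite_induct) (auto intro: order_trans[OF N_triangle])
  have "N x \<le> (\<Sum>b\<in>Basis. N b) * norm x" for x
  proof -
    have "N x \<le> (\<Sum>b\<in>Basis. \<bar>x \<bullet> b\<bar> * N b)"
      using N_sum[of Basis "\<lambda>b. (x \<bullet> b) *\<^sub>R b"] by (simp add: euclidean_representation N_scale)
    also have "\<dots> \<le> (\<Sum>b\<in>Basis. norm x * N b)"
      by (intro sum_mono mult_right_mono Basis_le_norm) auto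
    finally show ?thesis by (simp add: sum_distrib_left mult.commute)
  qed
  moreover have "(\<Sum>b\<in>Basis. N b) * norm x \<le> ((\<Sum>b\<in>Basis. N b) + 1) * norm x" for x :: 'v
    by (intro mult_right_mono) auto
  moreover have "(\<Sum>b\<in>Basis. N b) + 1 > 0"
    by (intro add_nonneg_pos sum_nonneg) auto
  ultimately show ?thesis using that[of "(\<Sum>b\<in>Basis. N b) + 1"] by (meson order_trans)
qed

lemma N_continuous: "continuous_on A N"
proof -
  obtain c where c: "c > 0" "\<And>x. N x \<le> c * norm x" using N_bounded by blast
  have *: "N x - N y \<le> c * dist x y" for x y
    using N_triangle[of y "x - y"] c(2)[of "x - y"] by (simp add: dist_norm)
  have "c-lipschitz_on A N"
  proof (rule lipschitz_onI)
    show "dist (N x) (N y) \<le> c * dist x y" for x y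
      using *[of x y] *[of y x] by (auto simp: dist_real_def abs_le_iff dist_commute)
  qed (use c in auto)
  then show ?thesis by (rule lipschitz_on_continuous_on)
qed

section \<open>Ellipsoids inside the unit ball of the norm\<close>

definition dominating :: "('v \<Rightarrow>\<^sub>L 'v) set" where
  "dominating = {T. \<forall>x. N x \<le> norm (blinfun_apply T x)}"

text \<open>The squared Hilbert-Schmidt norm. It plays the role that volume plays for John's
  ellipsoid, and it is a quadratic expression, so its change under a rank-one perturbation is
  explicit.\<close>

definition energy :: "('v \<Rightarrow>\<^sub>L 'v) \<Rightarrow> real" where
  "energy T = (\<Sum>b\<in>Basis. (norm (T b))\<^sup>2)"

lemma dominating_minimal:
  obtains T where "T \<in> dominating" "\<And>T'. T' \<in> dominating \<Longrightarrow> energy T \<le> energy T'"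
proof -
  obtain c where c: "c > 0" "\<And>x. N x \<le> c * norm x" using N_bounded by blast
  define T0 where "T0 = c *\<^sub>R (id_blinfun :: 'v \<Rightarrow>\<^sub>L 'v)"
  have T0: "T0 \<in> dominating"
    using c by (simp add: dominating_def T0_def blinfun.scaleR_left)
  define r where "r = real DIM('v) * sqrt (energy T0)"
  define S where "S = dominating \<inter> {T. energy T \<le> energy T0}"
  have "S \<subseteq> cball 0 r"
  proof
    fix T assume "T \<in> S"
    then have T: "energy T \<le> energy T0" by (simp add: S_def)
    have "norm (T b) \<le> sqrt (energy T0)" if "b \<in> Basis" for b
    proof (rule real_le_rsqrt)
      have "(norm (T b))\<^sup>2 \<le> energy T"
        unfolding energy_def using that by (intro member_le_sum) auto
      then show "(norm (T b))\<^sup>2 \<le> energy T0" using T by simp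
    qed
    then have "(\<Sum>b\<in>Basis. norm (T b)) \<le> r"
      unfolding r_def by (intro sum_bounded_above[THEN order_trans]) auto
    then show "T \<in> cball 0 r"
      using norm_blinfun_euclidean_le[of T] by simp
  qed
  moreover have "closed S"
  proof -
    have "dominating = (\<Inter>x. {T. N x \<le> norm (blinfun_apply T x)})"
      by (auto simp: dominating_def)
    moreover have "closed {T. N x \<le> norm (blinfun_apply T x)}" for x
      by (intro closed_Collect_le continuous_intros)
    ultimately have "closed dominating" by auto
    moreover have "closed {T :: 'v \<Rightarrow>\<^sub>L 'v. energy T \<le> energy T0}"
      unfolding energy_def by (intro closed_Collect_le continuous_intros)
    ultimately show ?thesis unfolding S_def by (intro closed_Int)
  qed
  ultimately have "compact S"
    by (metis bounded_cball bounded_subset compact_eq_bounded_closed)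
  moreover have "S \<noteq> {}" using T0 by (auto simp: S_def)
  moreover have "continuous_on S energy"
    unfolding energy_def[abs_def] by (intro continuous_intros)
  ultimately obtain T where T: "T \<in> S" "\<And>T'. T' \<in> S \<Longrightarrow> energy T \<le> energy T'"
    using continuous_attains_inf[of S energy] by blast
  show ?thesis
  proof (rule that[of T])
    show "T \<in> dominating" using T by (simp add: S_def)
    fix T' assume "T' \<in> dominating"
    then show "energy T \<le> energy T'"
      using T by (cases "energy T' \<le> energy T0") (auto simp: S_def)
  qed
qed

end

section \<open>The contact cone of a dominated norm\<close>

locale dominated_ptolemaic_norm = ptolemaic_norm +
  assumes N_le: "N x \<le> norm x"
begin

definition contact :: "'a set" where
  "contact = {x. N x = norm x}"

lemma contact_scale: "x \<in> contact \<Longrightarrow> c *\<^sub>R x \<in> contact"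
  by (simp add: contact_def N_scale)

lemma contact_scale_cancel: "\<lbrakk>c *\<^sub>R x \<in> contact; c \<noteq> 0\<rbrakk> \<Longrightarrow> x \<in> contact"
  by (simp add: contact_def N_scale)

text \<open>Apply Ptolemy to \<open>a + b\<close> and \<open>a - b\<close>. With \<open>N\<close>
  replaced by the larger Euclidean norm the right side equals the left one, by the parallelogram law
  and \<open>norm a = norm b\<close>; so neither term on the right can have lost anything.\<close>

lemma contact_bisector:
  assumes "a \<in> contact" "b \<in> contact" "norm a = norm b"
  shows "a + b \<in> contact"
proof -
  have "N (2 *\<^sub>R a) * N (2 *\<^sub>R b) \<le> (N (a + b))\<^sup>2 + (N (a - b))\<^sup>2"
    using N_ptolemy[of "a + b" "a - b"] by (simp add: scaleR_2)
  then have "4 * (norm a * norm b) \<le> (N (a + b))\<^sup>2 + (N (a - b))\<^sup>2"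
    using assms by (simp add: contact_def N_scale)
  moreover have "(norm (a + b))\<^sup>2 + (norm (a - b))\<^sup>2 = 4 * (norm a * norm b)"
  proof -
    have "(norm (a + b))\<^sup>2 + (norm (a - b))\<^sup>2 = 2 * (norm a)\<^sup>2 + 2 * (norm b)\<^sup>2"
      by (simp add: power2_norm_eq_inner inner_add_left inner_add_right inner_diff_left
          inner_diff_right inner_commute)
    then show ?thesis using assms(3) by (simp add: power2_eq_square)
  qed
  moreover have "(N (a - b))\<^sup>2 \<le> (norm (a - b))\<^sup>2"
    by (intro power_mono N_le) auto
  ultimately have "(norm (a + b))\<^sup>2 \<le> (N (a + b))\<^sup>2" by linarith
  then have "norm (a + b) \<le> N (a + b)" by (rule power2_le_imp_le) simp
  then show ?thesis using N_le[of "a + b"] by (simp add: contact_def)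
qed

lemma contact_closed: "closed contact"
proof -
  have "contact = {x. norm x \<le> N x}"
    using N_le by (auto simp: contact_def antisym)
  then show ?thesis
    by (simp add: closed_Collect_le N_continuous continuous_on_norm_id)
qed

text \<open>A gap in the set of contact points of a segment would contain the bisector of its ends.\<close>

lemma contact_segment:
  assumes a: "a \<in> contact" and b: "b \<in> contact" and t: "0 \<le> t" "t \<le> 1"
  shows "a + t *\<^sub>R (b - a) \<in> contact"
proof (rule ccontr)
  define p where "p s = a + s *\<^sub>R (b - a)" for s
  define A where "A = {s. p s \<in> contact}"
  assume "a + t *\<^sub>R (b - a) \<notin> contact"
  then have tA: "t \<notin> A" by (simp add: A_def p_def)
  have "closed A"
    unfolding A_def vimage_def[symmetric] p_def
    by (intro closed_vimage contact_closed continuous_intros)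
  have 0: "0 \<in> A" and 1: "1 \<in> A" using a b by (auto simp: A_def p_def)
  have "compact ({0..t} \<inter> A)" "{0..t} \<inter> A \<noteq> {}"
    using 0 t \<open>closed A\<close> by (auto intro!: compact_Int_closed)
  then obtain t1 where t1: "t1 \<in> {0..t} \<inter> A" "\<And>s. s \<in> {0..t} \<inter> A \<Longrightarrow> s \<le> t1"
    using compact_attains_sup[of "{0..t} \<inter> A"] by blast
  have "compact ({t..1} \<inter> A)" "{t..1} \<inter> A \<noteq> {}"
    using 1 t \<open>closed A\<close> by (auto intro!: compact_Int_closed)
  then obtain t2 where t2: "t2 \<in> {t..1} \<inter> A" "\<And>s. s \<in> {t..1} \<inter> A \<Longrightarrow> t2 \<le> s"
    using compact_attains_inf[of "{t..1} \<inter> A"] by blast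
  have tt: "t1 < t" "t < t2" using t1(1) t2(1) tA by (auto simp: less_le)
  have gap: "s \<notin> A" if "t1 < s" "s < t2" for s
    using t1(2)[of s] t2(2)[of s] t1(1) t2(1) that by (cases "s \<le> t") auto
  have pt: "p t1 \<in> contact" "p t2 \<in> contact" using t1 t2 by (auto simp: A_def)
  have diff: "p s - p s' = (s - s') *\<^sub>R (b - a)" for s s' by (simp add: p_def algebra_simps)
  \<comment> \<open>Equal-norm rescaling of the two ends needs both to be nonzero. If one were 0,
    the segment would lie on a line through the origin that contains a nonzero contact point, hence
    consists of contact points.\<close>
  have nz: "p t1 \<noteq> 0 \<and> p t2 \<noteq> 0"
  proof (rule ccontr)
    assume "\<not> ?thesis"
    then obtain s where s: "p s = 0" by auto
    have ps: "p s' = (s' - s) *\<^sub>R (b - a)" for s'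
      using diff[of s' s] s by simp
    have "b - a \<in> contact"
    proof (cases "s = t1")
      case True
      then show ?thesis using pt(2) ps[of t2] tt contact_scale_cancel[of "t2 - s" "b - a"] by auto
    next
      case False
      then show ?thesis using pt(1) ps[of t1] contact_scale_cancel[of "t1 - s" "b - a"] by auto
    qed
    then have "t \<in> A" using ps[of t] contact_scale[of "b - a" "t - s"] by (simp add: A_def)
    then show False using tA by simp
  qed
  \<comment> \<open>Each end is weighted with the norm of the other. The weighted ends have equal
    norms, and their sum is a positive multiple of the point \<open>p s\<close> inside the
    gap.\<close>
  define \<alpha> \<beta> where "\<alpha> = norm (p t2)" and "\<beta> = norm (p t1)"
  have \<alpha>\<beta>: "\<alpha> > 0" "\<beta> > 0" using nz by (auto simp: \<alpha>_def \<beta>_def)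
  define s where "s = (\<alpha> * t1 + \<beta> * t2) / (\<alpha> + \<beta>)"
  have "\<alpha> *\<^sub>R p t1 + \<beta> *\<^sub>R p t2 \<in> contact"
    by (intro contact_bisector contact_scale pt) (simp add: \<alpha>_def \<beta>_def)
  also have "\<alpha> *\<^sub>R p t1 + \<beta> *\<^sub>R p t2 = (\<alpha> + \<beta>) *\<^sub>R p s"
  proof -
    have "(\<alpha> + \<beta>) *\<^sub>R p s = (\<alpha> + \<beta>) *\<^sub>R a + ((\<alpha> + \<beta>) * s) *\<^sub>R (b - a)"
      by (simp add: p_def scaleR_add_right)
    also have "(\<alpha> + \<beta>) * s = \<alpha> * t1 + \<beta> * t2" using \<alpha>\<beta> by (simp add: s_def)
    finally show ?thesis by (simp add: p_def algebra_simps)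
  qed
  finally have "s \<in> A" using \<alpha>\<beta> contact_scale_cancel[of "\<alpha> + \<beta>" "p s"] by (simp add: A_def)
  moreover have "t1 < s" "s < t2"
    using \<alpha>\<beta> tt by (auto simp: s_def field_simps)
  ultimately show False using gap by blast
qed

lemma contact_subspace: "subspace contact"
  unfolding subspace_def
proof (intro conjI ballI allI)
  show "0 \<in> contact" by (simp add: contact_def)
  fix x y assume "x \<in> contact" "y \<in> contact"
  then have "2 *\<^sub>R (x + (1/2) *\<^sub>R (y - x)) \<in> contact"
    by (intro contact_scale contact_segment) auto
  then show "x + y \<in> contact" by (simp add: algebra_simps scaleR_2)
qed (rule contact_scale)

text \<open>Take \<open>w\<close> orthogonal to the contact set. On unit vectors with
  \<open>\<bar>w \<bullet> x\<bar> \<ge> \<eta>\<close> compactness leaves a gap between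
  \<open>N\<close> and 1, so shrinking by \<open>c\<close> along \<open>w\<close> is harmless there.
  On the others shrinking costs only order \<open>c * \<eta>\<^sup>2\<close>, which the dilation by
  \<open>1 + \<delta>\<close> repairs. The point is that \<delta> is small compared with
  \<open>c\<close>, however small \<open>c\<close> has to be.\<close>

lemma shrinking_direction:
  assumes "contact \<noteq> UNIV" "\<eta>0 > 0"
  obtains w \<eta> c \<delta> where "norm w = 1" "0 < \<eta>" "\<eta> \<le> \<eta>0" "0 < c" "c \<le> 1/2" "\<delta> = 2 * c * \<eta>\<^sup>2" "\<eta> \<le> 1"
    "\<And>x. N x \<le> norm ((1 + \<delta>) *\<^sub>R x - (c * (w \<bullet> x)) *\<^sub>R w)"
proof -
  have "dim contact < DIM('a)"
    using contact_subspace assms(1) by (metis dim_eq_full dim_subset_UNIV nless_le span_eq_iff)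
  then obtain w0 where w0: "w0 \<noteq> 0" "span contact \<subseteq> {x. w0 \<bullet> x = 0}"
    using lowdim_subset_hyperplane by blast
  define w where "w = w0 /\<^sub>R norm w0"
  have w: "norm w = 1" "\<And>x. x \<in> contact \<Longrightarrow> w \<bullet> x = 0"
    using w0 span_superset[of contact] by (auto simp: w_def)
  define \<eta> where "\<eta> = min 1 \<eta>0"
  have \<eta>: "0 < \<eta>" "\<eta> \<le> 1" "\<eta> \<le> \<eta>0" using assms(2) by (auto simp: \<eta>_def)
  define K where "K = sphere 0 1 \<inter> {x. \<eta> \<le> \<bar>w \<bullet> x\<bar>}"
  have "compact K"
    unfolding K_def by (intro compact_Int_closed closed_Collect_le continuous_intros) simp
  moreover have "w \<in> K" using w \<eta> by (simp add: K_def dot_square_norm)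
  ultimately obtain z where z: "z \<in> K" "\<And>x. x \<in> K \<Longrightarrow> N x \<le> N z"
    using continuous_attains_sup[OF \<open>compact K\<close> _ N_continuous] by blast
  have "N z < 1"
  proof (rule ccontr)
    assume "\<not> N z < 1"
    then have "z \<in> contact" using N_le[of z] z(1) by (simp add: contact_def K_def)
    then show False using w(2)[of z] z(1) \<eta> by (simp add: K_def)
  qed
  define c where "c = min (1 - N z) (1/2)"
  have c: "0 < c" "c \<le> 1 / 2" "c \<le> 1 - N z"
    using \<open>N z < 1\<close> min.cobounded1[of "1 - N z" "1 / 2"] min.cobounded2[of "1 - N z" "1 / 2"]
    unfolding c_def by auto
  have cK: "N x \<le> 1 - c" if "x \<in> K" for x
    using z(2)[OF that] c(3) by linarith
  \<comment> \<open>Chosen so that the gain \<open>2 * \<delta>\<close> in the squared norm balances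
    the loss, which is at most \<open>4 * c * \<eta>\<^sup>2\<close>.\<close>
  define \<delta> where "\<delta> = 2 * c * \<eta>\<^sup>2"
  have \<delta>: "\<delta> \<ge> 0" "\<delta> \<le> 1"
    using c \<eta> power_le_one[of \<eta> 2] mult_mono[of c "1/2" "\<eta>\<^sup>2" 1] by (auto simp: \<delta>_def)
  define S where "S x = (1 + \<delta>) *\<^sub>R x - (c * (w \<bullet> x)) *\<^sub>R w" for x
  have unit: "N x \<le> norm (S x)" if x: "norm x = 1" for x
  proof (cases "\<eta> \<le> \<bar>w \<bullet> x\<bar>")
    case True
    then have "N x \<le> 1 - c" using cK x by (simp add: K_def)
    also have "\<dots> \<le> norm (S x)"
    proof -
      have "\<bar>w \<bullet> x\<bar> \<le> 1" using Cauchy_Schwarz_ineq2[of w x] w x by simp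
      then have "norm ((c * (w \<bullet> x)) *\<^sub>R w) \<le> c"
        using c mult_left_mono[of "\<bar>w \<bullet> x\<bar>" 1 c] w by (simp add: abs_mult)
      then show ?thesis
        unfolding S_def using norm_triangle_ineq2[of "(1 + \<delta>) *\<^sub>R x" "(c * (w \<bullet> x)) *\<^sub>R w"] \<delta> x by simp
    qed
    finally show ?thesis .
  next
    case False
    define q where "q = (w \<bullet> x)\<^sup>2"
    have ww: "w \<bullet> w = 1" "x \<bullet> x = 1" using w x by (auto simp: dot_square_norm)
    have q: "0 \<le> q" "q \<le> \<eta>\<^sup>2"
      using False \<eta> abs_le_square_iff[of "w \<bullet> x" \<eta>] by (auto simp: q_def)
    have "(norm (S x))\<^sup>2 = (1 + \<delta>)\<^sup>2 - (2 * c * (1 + \<delta>) - c\<^sup>2) * q"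
      unfolding power2_norm_eq_inner S_def q_def
      by (simp add: inner_diff_left inner_diff_right ww inner_commute[of x w] power2_eq_square algebra_simps)
    moreover have "(2 * c * (1 + \<delta>) - c\<^sup>2) * q \<le> (2 * c * (1 + 1)) * \<eta>\<^sup>2"
    proof (intro mult_mono q)
      have "2 * c * (1 + \<delta>) \<le> 2 * c * (1 + 1)" using c \<delta> by (intro mult_left_mono) auto
      moreover have "c\<^sup>2 \<ge> 0" by simp
      ultimately show "2 * c * (1 + \<delta>) - c\<^sup>2 \<le> 2 * c * (1 + 1)" by linarith
    qed (use c q in auto)
    moreover have "(1 + \<delta>)\<^sup>2 \<ge> 1 + 2 * \<delta>" by (simp add: power2_eq_square algebra_simps)
    ultimately have "1\<^sup>2 \<le> (norm (S x))\<^sup>2" by (simp add: \<delta>_def)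
    then have "1 \<le> norm (S x)" by (rule power2_le_imp_le) simp
    then show ?thesis using N_le[of x] x by simp
  qed
  have "N x \<le> norm (S x)" for x
  proof (cases "x = 0")
    case False
    have "S (x /\<^sub>R norm x) = S x /\<^sub>R norm x"
      by (simp add: S_def scaleR_diff_right mult.commute)
    then show ?thesis
      using unit[of "x /\<^sub>R norm x"] False by (simp add: N_scale field_simps)
  qed (simp add: S_def)
  then show ?thesis
    using that[of w \<eta> c \<delta>] w \<eta> c \<delta>_def by (simp add: S_def)
qed

end

context ptolemaic_norm
begin

text \<open>Schoenberg's theorem in finite dimension. If the contact set were proper, composing the
  minimal \<open>T\<close> with the operator of \<open>shrinking_direction\<close> would save energy
  of order \<open>c\<close> at a cost of order \<open>c * \<eta>\<^sup>2\<close>.\<close>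

theorem euclidean:
  obtains T :: "'v \<Rightarrow>\<^sub>L 'v" where "\<And>x. norm (T x) = N x"
proof -
  obtain T where T: "T \<in> dominating" and min: "\<And>T'. T' \<in> dominating \<Longrightarrow> energy T \<le> energy T'"
    using dominating_minimal by blast
  have lin_T: "linear (blinfun_apply T)" by (simp add: blinfun.bounded_linear_right bounded_linear.linear)
  have "inj T"
  proof (rule injI)
    fix x y assume "T x = T y"
    then have "T (x - y) = 0" by (simp add: blinfun.diff_right)
    then have "N (x - y) \<le> 0" using T unfolding dominating_def by (metis mem_Collect_eq norm_zero)
    then show "x = y" using N_definite by fastforce
  qed
  then obtain R where R: "linear R" "\<And>x. R (T x) = x" "\<And>y. T (R y) = y"
    using linear_injective_isomorphism[OF lin_T] by blast
  interpret D: dominated_ptolemaic_norm "\<lambda>y. N (R y)"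
  proof
    fix x y :: 'v and c :: real
    show "N (R (c *\<^sub>R x)) = \<bar>c\<bar> * N (R x)" by (simp add: linear_scale[OF R(1)] N_scale)
    show "N (R (x + y)) \<le> N (R x) + N (R y)" by (simp add: linear_add[OF R(1)] N_triangle)
    show "x = 0" if "N (R x) \<le> 0"
      using N_definite[OF that] R(3)[of x] by (metis blinfun.zero_right)
    show "N (R (x + y)) * N (R (x - y)) \<le> (N (R x))\<^sup>2 + (N (R y))\<^sup>2"
      by (simp add: linear_add[OF R(1)] linear_diff[OF R(1)] N_ptolemy)
    show "N (R x) \<le> norm x"
      using T R(3)[of x] by (metis dominating_def mem_Collect_eq)
  qed
  have "D.contact = UNIV"
  proof (rule ccontr)
    assume nU: "D.contact \<noteq> UNIV"
    define E where "E = energy T"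
    have "E \<ge> 0" by (simp add: E_def energy_def sum_nonneg)
    define \<tau> where "\<tau> w = (\<Sum>b\<in>Basis. (w \<bullet> T b)\<^sup>2)" for w
    have \<tau>_eq: "\<tau> w = (norm (adjoint T w))\<^sup>2" for w
    proof -
      have "w \<bullet> T b = adjoint T w \<bullet> b" for b
        by (simp add: adjoint_works[OF lin_T] inner_commute)
      then have "\<tau> w = (\<Sum>b\<in>Basis. (adjoint T w \<bullet> b)\<^sup>2)" by (simp add: \<tau>_def)
      then show ?thesis
        unfolding power2_norm_eq_inner by (subst euclidean_inner) (simp add: power2_eq_square)
    qed
    \<comment> \<open>\<open>w\<close> is only delivered together with \<eta>, while \<eta> must be
      small compared with the saving along \<open>w\<close>; so the saving is bounded below
      uniformly on the sphere.\<close>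
    have "\<exists>k>0. \<forall>w. norm w = 1 \<longrightarrow> k \<le> \<tau> w"
    proof -
      have "continuous_on (sphere 0 1) \<tau>" unfolding \<tau>_def[abs_def] by (intro continuous_intros)
      moreover have "sphere (0 :: 'v) 1 \<noteq> {}"
        by (simp add: sphere_eq_empty)
      ultimately obtain w where w: "norm w = 1" "\<And>v. norm v = 1 \<Longrightarrow> \<tau> w \<le> \<tau> v"
        using continuous_attains_inf[of "sphere 0 1" \<tau>] by auto
      have "\<tau> w > 0"
      proof (rule ccontr)
        assume "\<not> \<tau> w > 0"
        then have "adjoint T w = 0" by (simp add: \<tau>_eq)
        then have "w \<bullet> T (R w) = 0"
          by (metis adjoint_works[OF lin_T] inner_commute inner_zero_left)
        then show False using w(1) R(3) by simp
      qed
      then show ?thesis using w by blast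
    qed
    then obtain k where k: "k > 0" "\<And>w. norm w = 1 \<Longrightarrow> k \<le> \<tau> w" by blast
    \<comment> \<open>The cost is at most
      \<open>3 * \<delta> * (E + 1) = 6 * c * \<eta>\<^sup>2 * (E + 1)\<close>; a 7 in place of the
      6 makes the comparison with \<open>c * k\<close> strict.\<close>
    have pos: "k / (7 * (E + 1)) > 0" using k \<open>E \<ge> 0\<close> by simp
    obtain w \<eta> c \<delta> where w: "norm w = 1" and \<eta>: "0 < \<eta>" "\<eta> \<le> k / (7 * (E + 1))" "\<eta> \<le> 1"
      and c: "0 < c" "c \<le> 1/2" and \<delta>: "\<delta> = 2 * c * \<eta>\<^sup>2"
      and le: "\<And>x. N (R x) \<le> norm ((1 + \<delta>) *\<^sub>R x - (c * (w \<bullet> x)) *\<^sub>R w)"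
      by (rule D.shrinking_direction[OF nU pos]) blast
    define S where "S x = (1 + \<delta>) *\<^sub>R x - (c * (w \<bullet> x)) *\<^sub>R w" for x
    have S: "bounded_linear S" unfolding S_def
      by (intro bounded_linear_intros)
    define T' where "T' = Blinfun S o\<^sub>L T"
    have T': "T' x = S (T x)" for x
      by (simp add: T'_def bounded_linear_Blinfun_apply[OF S])
    have "T' \<in> dominating"
      using le[of "T _"] by (auto simp: dominating_def T' S_def R(2))
    then have "E \<le> energy T'" unfolding E_def by (rule min)
    define \<epsilon> where "\<epsilon> = 2 * c * (1 + \<delta>) - c\<^sup>2"
    have "(norm (S x))\<^sup>2 = (1 + \<delta>)\<^sup>2 * (norm x)\<^sup>2 - \<epsilon> * (w \<bullet> x)\<^sup>2" for x
    proof -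
      have "w \<bullet> w = 1" using w by (simp add: dot_square_norm)
      then show ?thesis
        unfolding power2_norm_eq_inner S_def \<epsilon>_def
        by (simp add: inner_diff_left inner_diff_right inner_commute[of x w] power2_eq_square algebra_simps)
    qed
    then have "energy T' = (1 + \<delta>)\<^sup>2 * E - \<epsilon> * \<tau> w"
      by (simp add: energy_def T' E_def \<tau>_def sum_subtractf sum_distrib_left)
    moreover have "(1 + \<delta>)\<^sup>2 * E - \<epsilon> * \<tau> w < E"
    proof -
      have "\<eta>\<^sup>2 \<le> \<eta>" using \<eta> by (simp add: power2_eq_square mult_left_le)
      then have "\<eta>\<^sup>2 \<le> k / (7 * (E + 1))" using \<eta> by linarith
      then have \<eta>2: "7 * \<eta>\<^sup>2 * (E + 1) \<le> k" using \<open>E \<ge> 0\<close> by (simp add: field_simps)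
      have \<delta>1: "0 \<le> \<delta>" "\<delta> \<le> 1"
        using c \<eta> power_le_one[of \<eta> 2] mult_mono[of c "1/2" "\<eta>\<^sup>2" 1] by (auto simp: \<delta>)
      have "(2 * \<delta> + \<delta>\<^sup>2) * E \<le> 3 * \<delta> * (E + 1)"
        using \<delta>1 \<open>E \<ge> 0\<close> by (intro mult_mono) (auto simp: power2_eq_square mult_left_le)
      also have "\<dots> = c * (6 * \<eta>\<^sup>2 * (E + 1))" by (simp add: \<delta>)
      also have "\<dots> < c * k"
      proof -
        have "\<eta>\<^sup>2 * (E + 1) > 0" using \<eta> \<open>E \<ge> 0\<close> by (intro mult_pos_pos) auto
        then show ?thesis using \<eta>2 c by (intro mult_strict_left_mono) auto
      qed
      also have "\<dots> \<le> \<epsilon> * \<tau> w"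
      proof (intro mult_mono)
        have "c\<^sup>2 \<le> c" using c by (simp add: power2_eq_square mult_left_le)
        moreover have "c * \<delta> \<ge> 0" using c \<delta>1 by simp
        ultimately show "c \<le> \<epsilon>" by (simp add: \<epsilon>_def algebra_simps)
        then show "0 \<le> \<epsilon>" using c by simp
      qed (use k w in auto)
      finally show ?thesis by (simp add: power2_eq_square algebra_simps)
    qed
    ultimately show False using \<open>E \<le> energy T'\<close> by simp
  qed
  then have "T x \<in> D.contact" for x by simp
  then have "N (R (T x)) = norm (T x)" for x
    unfolding D.contact_def by blast
  then show ?thesis using that[of T] by (simp add: R(2))
qed

end

section \<open>Functions close to a Ptolemaic norm\<close>

lemma nonpos_if_multiples_bounded:
  fixes d B :: real
  assumes "\<And>k :: nat. real k * d \<le> B"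
  shows "d \<le> 0"
proof (rule ccontr)
  assume "\<not> d \<le> 0"
  then obtain k :: nat where "B < real k * d" using reals_Archimedean3[of d] by auto
  then show False using assms[of k] by simp
qed

text \<open>The weights \<open>1 / 2 ^ Suc k\<close> sum to 1. So the limit stays within the same
  \<open>C\<close> of the first term, which later keeps the limit norm at bounded distance.\<close>

lemma dyadic_limit:
  fixes a :: "nat \<Rightarrow> real"
  assumes "\<And>k. \<bar>a (Suc k) - a k\<bar> \<le> C / 2 ^ Suc k"
  obtains l where "a \<longlonglongrightarrow> l" "\<bar>l - a 0\<bar> \<le> C"
proof -
  have C: "C \<ge> 0" using order_trans[OF abs_ge_zero assms[of 0]] by simp
  have s: "(\<lambda>k. C * (1 / 2) ^ Suc k) sums (C * 1)"
    by (intro sums_mult power_half_series)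
  have "summable (\<lambda>k. a (Suc k) - a k)"
    using assms by (intro summable_comparison_test'[OF sums_summable[OF s]]) (simp add: power_divide)
  then have "(\<lambda>n. \<Sum>k<n. a (Suc k) - a k) \<longlonglongrightarrow> (\<Sum>k. a (Suc k) - a k)"
    by (rule summable_LIMSEQ)
  then have "(\<lambda>n. (a n - a 0) + a 0) \<longlonglongrightarrow> (\<Sum>k. a (Suc k) - a k) + a 0"
    unfolding sum_lessThan_telescope by (intro tendsto_intros)
  then have l: "a \<longlonglongrightarrow> (\<Sum>k. a (Suc k) - a k) + a 0" by simp
  have b: "\<bar>a n - a 0\<bar> \<le> C * (1 - 1 / 2 ^ n)" for n
  proof (induction n)
    case (Suc n)
    have "\<bar>a (Suc n) - a 0\<bar> \<le> C / 2 ^ Suc n + C * (1 - 1 / 2 ^ n)"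
      using Suc assms[of n] by linarith
    then show ?case by (simp add: field_simps)
  qed simp
  have "\<bar>a n - a 0\<bar> \<le> C" for n
    using b[of n] mult_left_mono[of "1 - 1 / 2 ^ n" 1 C] C by simp
  then have "\<bar>((\<Sum>k. a (Suc k) - a k) + a 0) - a 0\<bar> \<le> C"
    using tendsto_rabs[OF tendsto_diff[OF l tendsto_const[of "a 0"]]]
    by (intro LIMSEQ_le_const2) auto
  with l show ?thesis using that by blast
qed

text \<open>The norm axioms up to an additive constant, with homogeneity known only for the factor
  2. \<open>E\<close> need not be continuous; \<open>E_bounded\<close> is the regularity that
  carries homogeneity from integers to real factors.\<close>

locale coarse_norm =
  fixes E :: "'v::euclidean_space \<Rightarrow> real" and C c :: real
  assumes E_double: "\<bar>E (2 *\<^sub>R x) - 2 * E x\<bar> \<le> C"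
    and E_add: "E (x + y) \<le> E x + E y + C"
    and E_uminus: "E (- x) \<le> E x + C"
    and E_bounded: "norm x \<le> 1 \<Longrightarrow> E x \<le> C"
    and c_pos: "c > 0" and E_coercive: "c * norm x - C \<le> E x"
    and E_ptolemy: "E (x + y) * E (x - y) \<le> (E x + C)\<^sup>2 + (E y + C)\<^sup>2"
begin

definition N :: "'v \<Rightarrow> real" where
  "N x = lim (\<lambda>k. E (2 ^ k *\<^sub>R x) / 2 ^ k)"

lemma N_lim: "(\<lambda>k. E (2 ^ k *\<^sub>R x) / 2 ^ k) \<longlonglongrightarrow> N x" (is ?lim)
  and N_near: "\<bar>N x - E x\<bar> \<le> C" (is ?near)
proof -
  let ?a = "\<lambda>k. E (2 ^ k *\<^sub>R x) / 2 ^ k"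
  have "\<bar>?a (Suc k) - ?a k\<bar> \<le> C / 2 ^ Suc k" for k
  proof -
    have "?a (Suc k) - ?a k = (E (2 *\<^sub>R (2 ^ k *\<^sub>R x)) - 2 * E (2 ^ k *\<^sub>R x)) / 2 ^ Suc k"
      by (simp add: field_simps)
    then show ?thesis using E_double[of "2 ^ k *\<^sub>R x"] by (simp add: divide_right_mono)
  qed
  then obtain l where "?a \<longlonglongrightarrow> l" "\<bar>l - ?a 0\<bar> \<le> C" by (rule dyadic_limit)
  moreover from this(1) have "N x = l" unfolding N_def by (rule limI)
  ultimately show ?lim ?near by auto
qed

lemma tendsto_over_power2: "(\<lambda>k. B / 2 ^ k) \<longlonglongrightarrow> (0 :: real)"
  using tendsto_mult[OF tendsto_const[of B] LIMSEQ_power_zero[of "1/2 :: real"]]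
  by (simp add: power_divide)

lemma N_triangle: "N (x + y) \<le> N x + N y"
proof (rule LIMSEQ_le[OF N_lim])
  show "(\<lambda>k. E (2 ^ k *\<^sub>R x) / 2 ^ k + E (2 ^ k *\<^sub>R y) / 2 ^ k + C / 2 ^ k) \<longlonglongrightarrow> N x + N y"
    using tendsto_add[OF tendsto_add[OF N_lim N_lim] tendsto_over_power2] by simp
  have "E (2 ^ k *\<^sub>R (x + y)) / 2 ^ k \<le> E (2 ^ k *\<^sub>R x) / 2 ^ k + E (2 ^ k *\<^sub>R y) / 2 ^ k + C / 2 ^ k" for k
    using E_add[of "2 ^ k *\<^sub>R x" "2 ^ k *\<^sub>R y"]
    by (simp add: scaleR_add_right add_divide_distrib[symmetric] divide_right_mono)
  then show "\<exists>n0. \<forall>k\<ge>n0. E (2 ^ k *\<^sub>R (x + y)) / 2 ^ k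
      \<le> E (2 ^ k *\<^sub>R x) / 2 ^ k + E (2 ^ k *\<^sub>R y) / 2 ^ k + C / 2 ^ k" by blast
qed

text \<open>The additive error dies after division by \<open>2 ^ k\<close>. This serves
  \<open>x \<mapsto> - x\<close> here and the linear parts of the crystallographic group
  later.\<close>

lemma N_invariant_le:
  assumes "linear L" "\<And>x. E (L x) \<le> E x + B"
  shows "N (L x) \<le> N x"
proof (rule LIMSEQ_le[OF N_lim])
  show "(\<lambda>k. E (2 ^ k *\<^sub>R x) / 2 ^ k + B / 2 ^ k) \<longlonglongrightarrow> N x"
    using tendsto_add[OF N_lim tendsto_over_power2] by simp
  have "E (2 ^ k *\<^sub>R L x) / 2 ^ k \<le> E (2 ^ k *\<^sub>R x) / 2 ^ k + B / 2 ^ k" for k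
    using assms(2)[of "2 ^ k *\<^sub>R x"]
    by (simp add: linear_scale[OF assms(1)] add_divide_distrib[symmetric] divide_right_mono)
  then show "\<exists>n0. \<forall>k\<ge>n0. E (2 ^ k *\<^sub>R L x) / 2 ^ k \<le> E (2 ^ k *\<^sub>R x) / 2 ^ k + B / 2 ^ k" by blast
qed

lemma N_minus [simp]: "N (- x) = N x"
proof -
  have *: "N (- x) \<le> N x" for x
    by (rule N_invariant_le[where B = C]) (auto simp: linear_uminus E_uminus)
  show ?thesis using *[of x] *[of "- x"] by simp
qed

lemma N_ptolemy: "N (x + y) * N (x - y) \<le> (N x)\<^sup>2 + (N y)\<^sup>2"
proof (rule LIMSEQ_le)
  show "(\<lambda>k. E (2 ^ k *\<^sub>R (x + y)) / 2 ^ k * (E (2 ^ k *\<^sub>R (x - y)) / 2 ^ k)) \<longlonglongrightarrow> N (x + y) * N (x - y)"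
    by (intro tendsto_mult N_lim)
  show "(\<lambda>k. (E (2 ^ k *\<^sub>R x) / 2 ^ k + C / 2 ^ k)\<^sup>2 + (E (2 ^ k *\<^sub>R y) / 2 ^ k + C / 2 ^ k)\<^sup>2)
      \<longlonglongrightarrow> (N x)\<^sup>2 + (N y)\<^sup>2"
    using tendsto_add[OF N_lim tendsto_over_power2] by (intro tendsto_add tendsto_power) auto
  have "E (2 ^ k *\<^sub>R (x + y)) / 2 ^ k * (E (2 ^ k *\<^sub>R (x - y)) / 2 ^ k)
      \<le> (E (2 ^ k *\<^sub>R x) / 2 ^ k + C / 2 ^ k)\<^sup>2 + (E (2 ^ k *\<^sub>R y) / 2 ^ k + C / 2 ^ k)\<^sup>2" for k
  proof -
    have "E (2 ^ k *\<^sub>R (x + y)) * E (2 ^ k *\<^sub>R (x - y)) / (2 ^ k)\<^sup>2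
        \<le> ((E (2 ^ k *\<^sub>R x) + C)\<^sup>2 + (E (2 ^ k *\<^sub>R y) + C)\<^sup>2) / (2 ^ k)\<^sup>2"
      using E_ptolemy[of "2 ^ k *\<^sub>R x" "2 ^ k *\<^sub>R y"]
      by (intro divide_right_mono) (simp_all add: scaleR_add_right scaleR_diff_right)
    then show ?thesis
      by (simp only: add_divide_distrib[symmetric] power_divide times_divide_times_eq power2_eq_square)
  qed
  then show "\<exists>n0. \<forall>k\<ge>n0. E (2 ^ k *\<^sub>R (x + y)) / 2 ^ k * (E (2 ^ k *\<^sub>R (x - y)) / 2 ^ k)
      \<le> (E (2 ^ k *\<^sub>R x) / 2 ^ k + C / 2 ^ k)\<^sup>2 + (E (2 ^ k *\<^sub>R y) / 2 ^ k + C / 2 ^ k)\<^sup>2" by blast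
qed

lemma N_coercive: "c * norm x \<le> N x"
proof (rule LIMSEQ_le[OF _ N_lim])
  show "(\<lambda>k. c * norm x - C / 2 ^ k) \<longlonglongrightarrow> c * norm x"
    using tendsto_diff[OF tendsto_const tendsto_over_power2] by simp
  have "c * norm x - C / 2 ^ k \<le> E (2 ^ k *\<^sub>R x) / 2 ^ k" for k
    using divide_right_mono[OF E_coercive[of "2 ^ k *\<^sub>R x"], of "2 ^ k"]
    by (simp add: diff_divide_distrib)
  then show "\<exists>n0. \<forall>k\<ge>n0. c * norm x - C / 2 ^ k \<le> E (2 ^ k *\<^sub>R x) / 2 ^ k" by blast
qed

lemma N_nonneg: "N x \<ge> 0"
  using N_coercive[of x] c_pos order_trans[of 0 "c * norm x"] by simp

lemma N_power2: "N (2 ^ j *\<^sub>R x) = 2 ^ j * N x"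
proof -
  have "(\<lambda>k. 2 ^ j * (E (2 ^ (k + j) *\<^sub>R x) / 2 ^ (k + j))) \<longlonglongrightarrow> 2 ^ j * N x"
    by (intro tendsto_mult tendsto_const LIMSEQ_ignore_initial_segment[OF N_lim])
  moreover have "2 ^ j * (E (2 ^ (k + j) *\<^sub>R x) / 2 ^ (k + j)) = E (2 ^ k *\<^sub>R 2 ^ j *\<^sub>R x) / 2 ^ k" for k
    by (simp add: power_add)
  ultimately have "(\<lambda>k. E (2 ^ k *\<^sub>R 2 ^ j *\<^sub>R x) / 2 ^ k) \<longlonglongrightarrow> 2 ^ j * N x" by simp
  then show ?thesis using N_lim LIMSEQ_unique by blast
qed

lemma N_0 [simp]: "N 0 = 0"
  using N_power2[of 1 0] by simp

lemma N_nat_le: "N (real k *\<^sub>R x) \<le> real k * N x"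
proof (induction k)
  case (Suc k)
  then show ?case using N_triangle[of x "real k *\<^sub>R x"] by (simp add: algebra_simps)
qed simp

text \<open>The lower bound comes from filling up \<open>k\<close> to \<open>2 ^ k\<close>, where
  homogeneity is exact, and bounding the remaining \<open>2 ^ k - k\<close> copies by the triangle
  inequality.\<close>

lemma N_nat: "N (real k *\<^sub>R x) = real k * N x"
proof (rule antisym[OF N_nat_le])
  have k: "k \<le> 2 ^ k" by (simp add: less_imp_le)
  have "2 ^ k * N x = N (real k *\<^sub>R x + real (2 ^ k - k) *\<^sub>R x)"
    using k by (simp add: N_power2[symmetric] scaleR_add_left[symmetric] of_nat_diff)
  also have "\<dots> \<le> N (real k *\<^sub>R x) + real (2 ^ k - k) * N x"
    using N_triangle N_nat_le by (meson add_left_mono order_trans)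
  finally show "real k * N x \<le> N (real k *\<^sub>R x)"
    using k by (simp add: of_nat_diff algebra_simps)
qed

lemma N_bounded_segment: obtains B where "\<And>t. \<bar>t\<bar> \<le> 1 \<Longrightarrow> N (t *\<^sub>R x) \<le> B"
proof -
  obtain j :: nat where j: "norm x < 2 ^ j"
    using real_arch_pow[of 2 "norm x"] by auto
  have "N (t *\<^sub>R x) \<le> 2 ^ j * (2 * C)" if "\<bar>t\<bar> \<le> 1" for t
  proof -
    have "\<bar>t\<bar> * norm x \<le> 1 * 2 ^ j" using that j by (intro mult_mono) auto
    then have "norm ((t / 2 ^ j) *\<^sub>R x) \<le> 1" by (simp add: field_simps)
    then have "N ((t / 2 ^ j) *\<^sub>R x) \<le> 2 * C"
      using E_bounded[of "(t / 2 ^ j) *\<^sub>R x"] N_near[of "(t / 2 ^ j) *\<^sub>R x"] by linarith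
    moreover have "N (t *\<^sub>R x) = 2 ^ j * N ((t / 2 ^ j) *\<^sub>R x)"
      using N_power2[of j "(t / 2 ^ j) *\<^sub>R x"] by simp
    ultimately show ?thesis by simp
  qed
  then show ?thesis using that by blast
qed

text \<open>Rounding \<open>k * s\<close> down to an integer changes the norm by a bounded amount,
  uniformly in \<open>k\<close>. So \<open>k\<close> times the defect is bounded for all
  \<open>k\<close>, and the defect is 0.\<close>

lemma N_scale_pos:
  assumes "s \<ge> 0"
  shows "N (s *\<^sub>R x) = s * N x"
proof -
  obtain B where B: "\<And>t. \<bar>t\<bar> \<le> 1 \<Longrightarrow> N (t *\<^sub>R x) \<le> B" using N_bounded_segment by blast
  have *: "real k * \<bar>N (s *\<^sub>R x) - s * N x\<bar> \<le> B + N x" for k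
  proof -
    define m where "m = nat \<lfloor>real k * s\<rfloor>"
    define t where "t = real k * s - real m"
    have t: "0 \<le> t" "t \<le> 1" using assms by (auto simp: t_def m_def) linarith+
    have k: "(real k * s) *\<^sub>R x = real m *\<^sub>R x + t *\<^sub>R x"
      by (simp add: t_def algebra_simps)
    have "real k * N (s *\<^sub>R x) = N ((real k * s) *\<^sub>R x)"
      using N_nat[of k "s *\<^sub>R x"] by simp
    moreover have "N ((real k * s) *\<^sub>R x) \<le> real m * N x + B"
      using N_triangle[of "real m *\<^sub>R x" "t *\<^sub>R x"] B[of t] t k by (simp add: N_nat)
    moreover have "real m * N x \<le> N ((real k * s) *\<^sub>R x) + B"
      using N_triangle[of "(real k * s) *\<^sub>R x" "- (t *\<^sub>R x)"] B[of t] t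
      unfolding k by (simp add: N_nat)
    ultimately have "\<bar>real k * N (s *\<^sub>R x) - real m * N x\<bar> \<le> B" by linarith
    moreover have "real k * (s * N x) = real m * N x + t * N x" by (simp add: t_def algebra_simps)
    moreover have "0 \<le> t * N x" "t * N x \<le> N x"
      using t N_nonneg[of x] by (auto simp: mult_left_le_one_le)
    moreover have "real k * \<bar>N (s *\<^sub>R x) - s * N x\<bar> = \<bar>real k * N (s *\<^sub>R x) - real k * (s * N x)\<bar>"
      by (simp add: abs_mult right_diff_distrib[symmetric])
    ultimately show ?thesis by linarith
  qed
  have "\<bar>N (s *\<^sub>R x) - s * N x\<bar> \<le> 0"
    using * by (rule nonpos_if_multiples_bounded)
  then show ?thesis by simp
qed

lemma N_scale: "N (s *\<^sub>R x) = \<bar>s\<bar> * N x"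
proof (cases "s \<ge> 0")
  case False
  then show ?thesis using N_scale_pos[of "- s" x] by simp
qed (simp add: N_scale_pos)

sublocale ptolemaic_norm N
proof
  show "x = 0" if "N x \<le> 0" for x
    using N_coercive[of x] that c_pos by (smt (verit) mult_pos_pos zero_less_norm_iff)
qed (fact N_scale N_triangle N_ptolemy)+

end

section \<open>The asymptotic norm of a lattice action\<close>

locale lattice_action =
  fixes T :: "'v::euclidean_space set" and \<tau> :: "'v \<Rightarrow> 'x::metric_space \<Rightarrow> 'x" and x0 :: 'x
  assumes T_add: "\<lbrakk>v \<in> T; w \<in> T\<rbrakk> \<Longrightarrow> v + w \<in> T"
    and T_uminus: "v \<in> T \<Longrightarrow> - v \<in> T"
    and T_0: "0 \<in> T"
    and \<tau>_dist: "v \<in> T \<Longrightarrow> dist (\<tau> v x) (\<tau> v y) = dist x y"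
    and \<tau>_add: "\<lbrakk>v \<in> T; w \<in> T\<rbrakk> \<Longrightarrow> \<tau> (v + w) x = \<tau> v (\<tau> w x)"
    and \<tau>_0: "\<tau> 0 x = x"
    and T_finite: "finite {v \<in> T. norm v \<le> r}"
    and T_cobounded: "\<exists>R. \<forall>x. \<exists>v\<in>T. norm (x - v) \<le> R"
    and orbit_cobounded: "\<exists>R. \<forall>x. \<exists>v\<in>T. dist x (\<tau> v x0) \<le> R"
    and orbit_coercive: "\<exists>c>0. \<exists>C. \<forall>v\<in>T. c * norm v - C \<le> dist x0 (\<tau> v x0)"
    and convex_midpoint: "\<exists>m. dist x m = dist x y / 2 \<and> dist m y = dist x y / 2 \<and>
        (\<forall>p. dist p m \<le> (dist p x + dist p y) / 2)"
    and ptolemy: "dist x y * dist x' y' \<le> dist x x' * dist y y' + dist x y' * dist y x'"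
begin

definition D :: "'v \<Rightarrow> real" where
  "D v = dist x0 (\<tau> v x0)"

lemma T_diff: "\<lbrakk>v \<in> T; w \<in> T\<rbrakk> \<Longrightarrow> v - w \<in> T"
  using T_add[of v "- w"] T_uminus by simp

lemma T_scale: "v \<in> T \<Longrightarrow> real k *\<^sub>R v \<in> T"
  by (induction k) (auto simp: T_0 T_add scaleR_left.add)

lemma dist_orbit: "\<lbrakk>v \<in> T; w \<in> T\<rbrakk> \<Longrightarrow> dist (\<tau> v x0) (\<tau> w x0) = D (w - v)"
  using \<tau>_dist[of v x0 "\<tau> (w - v) x0"] \<tau>_add[of v "w - v" x0] T_diff by (simp add: D_def)

lemma D_0: "D 0 = 0"
  by (simp add: D_def \<tau>_0)

lemma D_nonneg [simp]: "D v \<ge> 0"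
  by (simp add: D_def)

lemma D_uminus: "v \<in> T \<Longrightarrow> D (- v) = D v"
  using dist_orbit[of v 0] dist_orbit[of 0 v] T_0 by (simp add: dist_commute)

lemma D_add: "\<lbrakk>v \<in> T; w \<in> T\<rbrakk> \<Longrightarrow> D (v + w) \<le> D v + D w"
  using dist_triangle[of x0 "\<tau> (v + w) x0" "\<tau> v x0"] dist_orbit[of v "v + w"] T_add
  by (simp add: D_def)

lemma D_diff: "\<lbrakk>v \<in> T; w \<in> T\<rbrakk> \<Longrightarrow> D (v - w) \<le> D v + D w"
  using D_add[of v "- w"] D_uminus[of w] T_uminus[of w] by simp

lemma D_perturb: "\<lbrakk>v \<in> T; w \<in> T\<rbrakk> \<Longrightarrow> D v \<le> D w + D (v - w)"
  using D_add[of w "v - w"] T_diff by simp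

lemma D_scale_le: "v \<in> T \<Longrightarrow> D (real k *\<^sub>R v) \<le> real k * D v"
proof (induction k)
  case (Suc k)
  then show ?case
    using D_add[of v "real k *\<^sub>R v"] T_scale[of v k] by (simp add: scaleR_left.add algebra_simps)
qed (simp add: D_0)

text \<open>Ptolemy for the orbit points of \<open>0\<close>, \<open>a\<close>,
  \<open>a + b\<close>, \<open>b\<close>.\<close>

lemma D_ptolemy:
  assumes "a \<in> T" "b \<in> T"
  shows "D (a + b) * D (a - b) \<le> (D a)\<^sup>2 + (D b)\<^sup>2"
proof -
  have "dist x0 (\<tau> (a + b) x0) * dist (\<tau> b x0) (\<tau> a x0)
      \<le> dist x0 (\<tau> b x0) * dist (\<tau> (a + b) x0) (\<tau> a x0) + dist x0 (\<tau> a x0) * dist (\<tau> (a + b) x0) (\<tau> b x0)"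
    by (rule ptolemy)
  moreover have "dist (\<tau> (a + b) x0) (\<tau> a x0) = D b" "dist (\<tau> (a + b) x0) (\<tau> b x0) = D a"
    "dist (\<tau> b x0) (\<tau> a x0) = D (a - b)"
    using assms by (simp_all add: dist_orbit T_add D_uminus)
  ultimately show ?thesis by (simp add: D_def power2_eq_square)
qed

text \<open>
  Summing the hypothesis over \<open>q = k e + i v\<close> telescopes in both \<open>k\<close> and \<open>i\<close>, so \<open>D (k e)\<close> grows
  at rate at most \<open>R\<close>.
\<close>

lemma bounded_drift:
  assumes e: "e \<in> T" and v: "v \<in> T"
    and mid: "\<And>q. q \<in> T \<Longrightarrow> D (q + e) \<le> R + (D (q - v) + D (q + v)) / 2"
    and coercive: "\<And>v. v \<in> T \<Longrightarrow> c * norm v - C \<le> D v"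
  shows "c * norm e \<le> R"
proof -
  define q where "q k i = real k *\<^sub>R e + real i *\<^sub>R v" for k i
  have qT: "q k i \<in> T" for k i
    unfolding q_def by (intro T_add T_scale e v)
  define g where "g k i = D (q k i)" for k i
  have q_Suc: "q k (Suc i) = q k i + v" "q (Suc k) i = q k i + e" for k i
    by (simp_all add: q_def algebra_simps)
  have step: "\<bar>g k (Suc i) - g k i\<bar> \<le> D v" for k i
    using D_add[OF qT v, of k i] D_diff[OF qT v, of k "Suc i"] by (simp add: g_def q_Suc)
  have mid': "g (Suc k) (Suc i) \<le> R + (g k i + g k (Suc (Suc i))) / 2" for k i
    using mid[OF qT, of k "Suc i"] by (simp add: g_def q_Suc add.commute add.left_commute)
  \<comment> \<open>For fixed \<open>n\<close> the sum over \<open>n\<close> points grows by at most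
    \<open>n * R + D v\<close> per step in \<open>k\<close>; letting \<open>k\<close> tend to
    infinity compares this with \<open>n * (c * norm e)\<close>. The remaining \<open>D v\<close>
    disappears when \<open>n\<close> grows.\<close>
  have main: "real n * (c * norm e - R) \<le> D v" for n :: nat
  proof -
    define G where "G k = (\<Sum>i<n. g k (Suc i))" for k
    have shift: "(\<Sum>i<n. g k i) = G k + g k 0 - g k n" for k
      using sum_lessThan_telescope[of "g k" n] by (simp add: G_def sum_subtractf)
    have shift2: "(\<Sum>i<n. g k (Suc (Suc i))) = G k + g k (Suc n) - g k 1" for k
      using sum_lessThan_telescope[of "\<lambda>i. g k (Suc i)" n] by (simp add: G_def sum_subtractf)
    have G_Suc: "G (Suc k) \<le> G k + (real n * R + D v)" for k
    proof -
      have "G (Suc k) \<le> (\<Sum>i<n. R + (g k i + g k (Suc (Suc i))) / 2)"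
        unfolding G_def by (intro sum_mono mid')
      also have "\<dots> = real n * R + ((\<Sum>i<n. g k i) + (\<Sum>i<n. g k (Suc (Suc i)))) / 2"
        by (simp add: sum.distrib sum_divide_distrib[symmetric])
      \<comment> \<open>Averaging the shifts by one step in both directions returns the same sum up
        to boundary terms. These pair into two differences of neighbours, bounded by
        \<open>D v\<close> independently of \<open>n\<close>.\<close>
      also have "\<dots> = real n * R + G k + ((g k 0 - g k 1) + (g k (Suc n) - g k n)) / 2"
        unfolding shift shift2 by (simp add: field_simps)
      also have "\<dots> \<le> G k + (real n * R + D v)"
        using step[of k 0] step[of k n] by simp
      finally show ?thesis .
    qed
    have G_le: "G k \<le> G 0 + real k * (real n * R + D v)" for k
    proof (induction k)
      case (Suc k)
      then show ?case using G_Suc[of k] by (simp add: algebra_simps)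
    qed simp
    have iv: "D (real (Suc i) *\<^sub>R v) \<le> real n * D v" if "i < n" for i
      using D_scale_le[OF v, of "Suc i"] mult_right_mono[of "real (Suc i)" "real n" "D v"] that by simp
    have G_ge: "real n * (D (real k *\<^sub>R e) - real n * D v) \<le> G k" for k
    proof -
      have "(\<Sum>i<n. D (real k *\<^sub>R e) - real n * D v) \<le> G k"
        unfolding G_def
      proof (rule sum_mono)
        fix i assume "i \<in> {..<n}"
        then have i: "i < n" by simp
        have "q k (Suc i) - real (Suc i) *\<^sub>R v = real k *\<^sub>R e" by (simp add: q_def)
        then show "D (real k *\<^sub>R e) - real n * D v \<le> g k (Suc i)"
          using D_diff[OF qT T_scale[OF v], of k "Suc i" "Suc i"] iv[OF i] by (simp add: g_def)
      qed
      then show ?thesis by simp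
    qed
    have G_0: "G 0 \<le> real n * (real n * D v)"
    proof -
      have "G 0 \<le> (\<Sum>i<n. real n * D v)"
        unfolding G_def using iv by (intro sum_mono) (simp add: g_def q_def)
      then show ?thesis by simp
    qed
    have "real k * (real n * (c * norm e) - (real n * R + D v)) \<le> real n * C + 2 * (real n * (real n * D v))" for k :: nat
    proof -
      have "real n * (c * norm (real k *\<^sub>R e) - C) \<le> real n * D (real k *\<^sub>R e)"
        by (intro mult_left_mono coercive T_scale e) simp
      then show ?thesis using G_le[of k] G_ge[of k] G_0 by (simp add: algebra_simps)
    qed
    then have "real n * (c * norm e) - (real n * R + D v) \<le> 0"
      by (rule nonpos_if_multiples_bounded)
    then show ?thesis by (simp add: algebra_simps)
  qed
  have "c * norm e - R \<le> 0"
    using main by (rule nonpos_if_multiples_bounded)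
  then show ?thesis by simp
qed

lemma D_bounded: obtains M where "M \<ge> 0" "\<And>v. \<lbrakk>v \<in> T; norm v \<le> r\<rbrakk> \<Longrightarrow> D v \<le> M"
proof -
  let ?S = "{v \<in> T. norm v \<le> r}"
  show ?thesis
  proof (rule that[of "sum D ?S"])
    show "0 \<le> sum D ?S" by (simp add: sum_nonneg)
    show "D v \<le> sum D ?S" if "v \<in> T" "norm v \<le> r" for v
      using that T_finite[of r] by (intro member_le_sum) auto
  qed
qed

lemma D_doubling: obtains B where "B \<ge> 0" "\<And>v. v \<in> T \<Longrightarrow> 2 * D v \<le> D (2 *\<^sub>R v) + B"
proof -
  obtain R where R: "\<And>x. \<exists>v\<in>T. dist x (\<tau> v x0) \<le> R" using orbit_cobounded by blast
  have "R \<ge> 0" using R[of x0] zero_le_dist order_trans by blast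
  obtain c C where c: "c > 0" "\<And>v. v \<in> T \<Longrightarrow> c * norm v - C \<le> D v"
    using orbit_coercive unfolding D_def by blast
  obtain M where M: "M \<ge> 0" "\<And>v. \<lbrakk>v \<in> T; norm v \<le> R / c\<rbrakk> \<Longrightarrow> D v \<le> M"
    using D_bounded by blast
  have "2 * D v \<le> D (2 *\<^sub>R v) + 2 * (R + M)" if v: "v \<in> T" for v
  proof -
    have v2: "2 *\<^sub>R v \<in> T" using T_add[OF v v] by (simp add: scaleR_2)
    obtain m where m: "dist x0 m = D (2 *\<^sub>R v) / 2"
      and conv: "\<And>p. dist p m \<le> (dist p x0 + dist p (\<tau> (2 *\<^sub>R v) x0)) / 2"
      using convex_midpoint[of x0 "\<tau> (2 *\<^sub>R v) x0"] unfolding D_def by blast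
    obtain w where w: "w \<in> T" "dist m (\<tau> w x0) \<le> R" using R by blast
    define e where "e = w - v"
    have e: "e \<in> T" unfolding e_def by (intro T_diff w v)
    have "c * norm e \<le> R"
    proof (rule bounded_drift[OF e v _ c(2)])
      fix q assume q: "q \<in> T"
      \<comment> \<open>Viewed from the orbit point of \<open>v - q\<close>, the distances to
        \<open>x0\<close>, to the orbit point of \<open>2 *\<^sub>R v\<close> and to that of
        \<open>w\<close> are \<open>D (q - v)\<close>, \<open>D (q + v)\<close> and
        \<open>D (q + e)\<close>. Convexity at \<open>m\<close> thus becomes an inequality in which
        \<open>q\<close> is free.\<close>
      have p: "v - q \<in> T" by (intro T_diff v q)
      have "D (q + e) = dist (\<tau> (v - q) x0) (\<tau> w x0)"
        using dist_orbit[OF p w(1)] by (simp add: e_def algebra_simps)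
      also have "\<dots> \<le> dist (\<tau> (v - q) x0) m + R"
        using dist_triangle[of "\<tau> (v - q) x0" "\<tau> w x0" m] w(2) by simp
      also have "dist (\<tau> (v - q) x0) m \<le> (dist (\<tau> (v - q) x0) x0 + dist (\<tau> (v - q) x0) (\<tau> (2 *\<^sub>R v) x0)) / 2"
        by (rule conv)
      also have "dist (\<tau> (v - q) x0) x0 = D (q - v)"
        using dist_orbit[OF p T_0] by (simp add: \<tau>_0)
      also have "dist (\<tau> (v - q) x0) (\<tau> (2 *\<^sub>R v) x0) = D (q + v)"
        using dist_orbit[OF p v2] by (simp add: scaleR_2 algebra_simps)
      finally show "D (q + e) \<le> R + (D (q - v) + D (q + v)) / 2" by simp
    qed
    then have "D e \<le> M" using c(1) by (intro M e) (simp add: field_simps)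
    have "D v \<le> D w + D e"
      using D_diff[OF w(1) e] by (simp add: e_def)
    also have "D w \<le> D (2 *\<^sub>R v) / 2 + R"
      using dist_triangle[of x0 "\<tau> w x0" m] m w(2) by (simp add: D_def)
    finally show ?thesis using \<open>D e \<le> M\<close> by simp
  qed
  then show ?thesis using that[of "2 * (R + M)"] \<open>R \<ge> 0\<close> M(1) by simp
qed

text \<open>\<open>D\<close> lives on the lattice only; rounding extends it to the whole space at
  bounded cost and yields a \<open>coarse_norm\<close>. The last conclusion is there to make the
  norm invariant under linear parts.\<close>

theorem asymptotic_norm:
  obtains N B where "ptolemaic_norm N" "\<And>v. v \<in> T \<Longrightarrow> \<bar>D v - N v\<bar> \<le> B"
    "\<And>L B' x. \<lbrakk>linear L; \<And>x. norm (L x) = norm x; \<And>v. v \<in> T \<Longrightarrow> L v \<in> T \<and> D (L v) \<le> D v + B'\<rbrakk>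
       \<Longrightarrow> N (L x) \<le> N x"
proof -
  obtain R where "\<And>x. \<exists>v\<in>T. norm (x - v) \<le> R" using T_cobounded by blast
  then have "\<forall>x. \<exists>v. v \<in> T \<and> norm (x - v) \<le> R" by blast
  then obtain r where r: "\<And>x. r x \<in> T \<and> norm (x - r x) \<le> R"
    using choice[of "\<lambda>x v. v \<in> T \<and> norm (x - v) \<le> R"] by blast
  then have rT: "r x \<in> T" and rR: "norm (x - r x) \<le> R" for x by auto
  have R: "R \<ge> 0" using rR[of 0] norm_ge_zero order_trans by blast
  obtain c C where c: "c > 0" "\<And>v. v \<in> T \<Longrightarrow> c * norm v - C \<le> D v"
    using orbit_coercive unfolding D_def by blast
  have C: "C \<ge> 0" using c(2)[OF T_0] by (simp add: D_0)
  \<comment> \<open>Comparing the rounding of a sum with the sum of the roundings involves three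
    errors of size \<open>R\<close>; the added 1 also admits the roundings of unit vectors.\<close>
  obtain M where M: "M \<ge> 0" "\<And>v. \<lbrakk>v \<in> T; norm v \<le> 3 * R + 1\<rbrakk> \<Longrightarrow> D v \<le> M"
    using D_bounded by blast
  obtain B where B: "B \<ge> 0" "\<And>v. v \<in> T \<Longrightarrow> 2 * D v \<le> D (2 *\<^sub>R v) + B"
    using D_doubling by blast
  define E where "E x = D (r x)" for x
  have near: "D v \<le> D w + M" if "v \<in> T" "w \<in> T" "norm (v - w) \<le> 3 * R + 1" for v w
    using D_perturb[of v w] M(2)[of "v - w"] T_diff[of v w] that by simp
  define K where "K = M + B + c * R + C"
  have K: "M \<le> K" using B(1) c(1) R C by (simp add: K_def)
  have add_near: "norm (r (x + y) - (r x + r y)) \<le> 3 * R" for x y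
  proof -
    have "r (x + y) - (r x + r y) = ((x - r x) + (y - r y)) - ((x + y) - r (x + y))" by simp
    also have "norm \<dots> \<le> norm ((x - r x) + (y - r y)) + norm ((x + y) - r (x + y))"
      by (rule norm_triangle_ineq4)
    also have "\<dots> \<le> 3 * R"
      using norm_triangle_ineq[of "x - r x" "y - r y"] rR[of x] rR[of y] rR[of "x + y"] by linarith
    finally show ?thesis .
  qed
  have diff_near: "norm (r (x - y) - (r x - r y)) \<le> 3 * R" for x y
  proof -
    have "r (x - y) - (r x - r y) = ((x - r x) - (y - r y)) - ((x - y) - r (x - y))" by simp
    also have "norm \<dots> \<le> norm ((x - r x) - (y - r y)) + norm ((x - y) - r (x - y))"
      by (rule norm_triangle_ineq4)
    also have "\<dots> \<le> 3 * R"
      using norm_triangle_ineq4[of "x - r x" "y - r y"] rR[of x] rR[of y] rR[of "x - y"] by linarith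
    finally show ?thesis .
  qed
  have E_add: "E (x + y) \<le> D (r x + r y) + M" "D (r x + r y) \<le> E (x + y) + M" for x y
    unfolding E_def using add_near[of x y] R
    by (auto intro!: near rT T_add simp: norm_minus_commute[of "r x + r y"])
  have E_diff: "E (x - y) \<le> D (r x - r y) + M" for x y
    unfolding E_def using diff_near[of x y] R by (auto intro!: near rT T_diff)
  interpret coarse_norm E K c
  proof
    fix x y
    show "\<bar>E (2 *\<^sub>R x) - 2 * E x\<bar> \<le> K"
      using E_add[of x x] B(2)[OF rT[of x]] D_add[OF rT rT, of x x] B(1) C R c(1)
      by (simp add: scaleR_2 K_def E_def) (smt (verit) mult_nonneg_nonneg)
    show "E (x + y) \<le> E x + E y + K"
      using E_add(1)[of x y] D_add[OF rT rT, of x y] K by (simp add: E_def)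
    show "E (- x) \<le> E x + K"
    proof -
      have "norm (r (- x) - (- r x)) \<le> 3 * R + 1"
        using norm_triangle_ineq[of "x - r x" "- x - r (- x)"] rR[of x] rR[of "- x"] R
        by (simp add: norm_minus_commute algebra_simps)
          (smt (verit) add.commute norm_minus_cancel minus_add_distrib uminus_add_conv_diff)
      then have "D (r (- x)) \<le> D (- r x) + M" by (intro near rT T_uminus)
      then show ?thesis using K by (simp add: E_def D_uminus rT)
    qed
    show "E x \<le> K" if "norm x \<le> 1"
    proof -
      have "norm (r x) \<le> 3 * R + 1"
        using norm_triangle_ineq4[of x "x - r x"] that rR[of x] R by simp
      then have "E x \<le> M" unfolding E_def by (intro M rT)
      then show ?thesis using K by simp
    qed
    show "c > 0" by fact
    show "c * norm x - K \<le> E x"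
    proof -
      have "norm x - R \<le> norm (r x)" using norm_triangle_ineq2[of x "r x"] rR[of x] by linarith
      then have "c * (norm x - R) \<le> c * norm (r x)" using c(1) by simp
      then show ?thesis
        using c(2)[OF rT[of x]] M(1) B(1) by (simp add: E_def K_def algebra_simps)
    qed
    show "E (x + y) * E (x - y) \<le> (E x + K)\<^sup>2 + (E y + K)\<^sup>2"
    proof -
      have nn: "E z \<ge> 0" for z by (simp add: E_def)
      let ?a = "r x" and ?b = "r y"
      have "E (x + y) * E (x - y) \<le> (D (?a + ?b) + M) * (D (?a - ?b) + M)"
        using M(1) nn by (intro mult_mono E_add E_diff) auto
      also have "\<dots> = D (?a + ?b) * D (?a - ?b) + M * (D (?a + ?b) + D (?a - ?b)) + M\<^sup>2"
        by (simp add: algebra_simps power2_eq_square)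
      also have "\<dots> \<le> ((D ?a)\<^sup>2 + (D ?b)\<^sup>2) + M * ((D ?a + D ?b) + (D ?a + D ?b)) + M\<^sup>2"
        by (intro add_mono mult_left_mono D_ptolemy D_add D_diff rT M order_refl)
      also have "\<dots> \<le> (E x + M)\<^sup>2 + (E y + M)\<^sup>2"
        by (simp add: E_def power2_eq_square algebra_simps)
      also have "\<dots> \<le> (E x + K)\<^sup>2 + (E y + K)\<^sup>2"
        using K M(1) nn by (intro add_mono power_mono) auto
      finally show ?thesis .
    qed
  qed
  show ?thesis
  proof (rule that[of N "K + M"])
    show "ptolemaic_norm N" by unfold_locales
    show "\<bar>D v - N v\<bar> \<le> K + M" if v: "v \<in> T" for v
    proof -
      have "norm (v - r v) \<le> 3 * R + 1" using rR[of v] R by linarith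
      then have "D v \<le> E v + M" "E v \<le> D v + M"
        unfolding E_def using v by (auto intro!: near rT simp: norm_minus_commute)
      then show ?thesis using N_near[of v] by linarith
    qed
    fix L :: "'v \<Rightarrow> 'v" and B' x
    assume L: "linear L" "\<And>x. norm (L x) = norm x"
      "\<And>v. v \<in> T \<Longrightarrow> L v \<in> T \<and> D (L v) \<le> D v + B'"
    show "N (L x) \<le> N x"
    proof (rule N_invariant_le[OF L(1)])
      fix x
      have "norm (r (L x) - L (r x)) \<le> norm (L x - r (L x)) + norm (L (x - r x))"
        using norm_triangle_ineq4[of "L (x - r x)" "L x - r (L x)"]
        by (simp add: linear_diff[OF L(1)])
      also have "\<dots> \<le> 3 * R + 1" using rR[of x] rR[of "L x"] L(2) R by simp
      finally have "D (r (L x)) \<le> D (L (r x)) + M" by (intro near rT) (use L(3) rT in auto)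
      also have "\<dots> \<le> D (r x) + B' + M" using L(3)[OF rT] by simp
      finally show "E (L x) \<le> E x + (B' + M)" by (simp add: E_def)
    qed
  qed
qed

end

section \<open>Proper cocompact actions\<close>

locale proper_cocompact_group = isometry_action_group G
  for G :: "('a::metric_space \<Rightarrow> 'a) set" +
  fixes K :: "'a set"
  assumes compact_K: "compact K"
    and translates_cover: "\<exists>g\<in>G. x \<in> g ` K"
    and proper: "\<exists>r>0. finite {g \<in> G. dist x (g x) < r}"
begin

text \<open>Properness speaks of one point moved near itself. For a pair, fix one admissible
  \<open>h\<close>: every other admissible \<open>g\<close> has \<open>inv h \<circ> g\<close>
  moving \<open>x'\<close> by less than \<open>r\<close>. Three errors of \<open>r / 6\<close> give
  \<open>r / 2\<close> for each of \<open>g\<close> and \<open>h\<close>.\<close>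

lemma finite_local_returns:
  obtains r where "r > 0"
    "finite {g \<in> G. \<exists>y y'. dist x y < r \<and> dist x' y' < r \<and> dist y (g y') < r}"
proof -
  obtain r where r: "r > 0" "finite {g \<in> G. dist x' (g x') < r}" using proper by blast
  let ?A = "{g \<in> G. \<exists>y y'. dist x y < r / 6 \<and> dist x' y' < r / 6 \<and> dist y (g y') < r / 6}"
  have near: "dist x (g x') < r / 2" if g: "g \<in> ?A" for g
  proof -
    obtain y y' where gG: "g \<in> G" and y: "dist x y < r / 6" "dist x' y' < r / 6" "dist y (g y') < r / 6"
      using g by auto
    have "dist x (g x') \<le> dist x y + dist y (g y') + dist (g y') (g x')"
      using dist_triangle[of x "g x'" y] dist_triangle[of y "g x'" "g y'"] by linarith
    then show ?thesis using y dist_eq[OF gG, of y' x'] by (simp add: dist_commute)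
  qed
  have "finite ?A"
  proof (cases "?A = {}")
    case False
    then obtain h where h: "h \<in> ?A" by blast
    then have hG: "h \<in> G" by blast
    have "?A \<subseteq> (\<lambda>s. h \<circ> s) ` {g \<in> G. dist x' (g x') < r}"
    proof
      fix g assume g: "g \<in> ?A"
      then have gG: "g \<in> G" by blast
      define s where "s = inv h \<circ> g"
      have sG: "s \<in> G" by (simp add: s_def comp_mem inv_mem hG gG)
      have gs: "g = h \<circ> s" using inv_right[OF hG] by (auto simp: s_def fun_eq_iff)
      have "dist x' (s x') = dist (h x') (g x')"
        using dist_eq[OF hG, of x' "s x'"] by (simp add: gs)
      also have "\<dots> < r"
        using near[OF g] near[OF h] dist_triangle2[of "h x'" "g x'" x] by (simp add: dist_commute)
      finally show "g \<in> (\<lambda>s. h \<circ> s) ` {g \<in> G. dist x' (g x') < r}"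
        using gs sG by blast
    qed
    then show ?thesis using r(2) by (rule finite_surj[rotated])
  qed (simp only: finite.emptyI)
  then show ?thesis using that[of "r / 6"] r(1) by simp
qed

definition returns :: "real \<Rightarrow> ('a \<Rightarrow> 'a) set" where
  "returns \<delta> = {g \<in> G. \<exists>k\<in>K. \<exists>k'\<in>K. dist k (g k') < \<delta>}"

text \<open>A finite subcover of \<open>K \<times> K\<close> by the neighbourhoods of
  \<open>finite_local_returns\<close> leaves finitely many elements, for \<delta> below all its
  radii.\<close>

lemma finite_returns: obtains \<delta> where "\<delta> > 0" "finite (returns \<delta>)"
proof -
  have "\<forall>p. \<exists>r>0. finite {g \<in> G. \<exists>y y'. dist (fst p) y < r \<and> dist (snd p) y' < r \<and> dist y (g y') < r}"
    using finite_local_returns by blast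
  then obtain r where r: "\<And>p. r p > 0"
    "\<And>p. finite {g \<in> G. \<exists>y y'. dist (fst p) y < r p \<and> dist (snd p) y' < r p \<and> dist y (g y') < r p}"
    using choice[of "\<lambda>p r. r > 0 \<and> finite {g \<in> G. \<exists>y y'. dist (fst p) y < r \<and> dist (snd p) y' < r \<and> dist y (g y') < r}"]
    by blast
  have "K \<times> K \<subseteq> (\<Union>p\<in>K \<times> K. ball (fst p) (r p) \<times> ball (snd p) (r p))"
    using r(1) by fastforce
  then obtain P where P: "P \<subseteq> K \<times> K" "finite P"
    "K \<times> K \<subseteq> (\<Union>p\<in>P. ball (fst p) (r p) \<times> ball (snd p) (r p))"
    by (rule compactE_image[OF compact_Times[OF compact_K compact_K], rotated]) (auto intro: open_Times)
  define \<delta> where "\<delta> = Min (insert 1 (r ` P))"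
  have \<delta>: "\<delta> > 0" "\<And>p. p \<in> P \<Longrightarrow> \<delta> \<le> r p"
    using P(2) r(1) by (auto simp: \<delta>_def)
  have "returns \<delta> \<subseteq> (\<Union>p\<in>P. {g \<in> G. \<exists>y y'. dist (fst p) y < r p \<and> dist (snd p) y' < r p \<and> dist y (g y') < r p})"
  proof
    fix g assume "g \<in> returns \<delta>"
    then obtain k k' where g: "g \<in> G" "k \<in> K" "k' \<in> K" "dist k (g k') < \<delta>"
      by (auto simp: returns_def)
    then obtain p where p: "p \<in> P" "(k, k') \<in> ball (fst p) (r p) \<times> ball (snd p) (r p)"
      using P(3) by blast
    then have "dist (fst p) k < r p" "dist (snd p) k' < r p" "dist k (g k') < r p"
      using g(4) \<delta>(2)[OF p(1)] by auto
    then show "g \<in> (\<Union>p\<in>P. {g \<in> G. \<exists>y y'. dist (fst p) y < r p \<and> dist (snd p) y' < r p \<and> dist y (g y') < r p})"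
      using p(1) g(1) by blast
  qed
  then have "finite (returns \<delta>)"
    by (rule finite_subset) (intro finite_UN_I P r)
  then show ?thesis using that \<delta>(1) by blast
qed

lemma transition_mem_returns:
  assumes "g \<in> G" "h \<in> G" "k \<in> K" "k' \<in> K" "dist (g k) (h k') < \<delta>"
  shows "inv g \<circ> h \<in> returns \<delta>"
proof -
  have "dist k (inv g (h k')) = dist (g k) (h k')"
    using dist_eq[OF assms(1), of k "inv g (h k')"] inv_right[OF assms(1)] by simp
  then have "dist k ((inv g \<circ> h) k') < \<delta>" using assms(5) by simp
  then show ?thesis
    unfolding returns_def using assms comp_mem[OF inv_mem] by blast
qed

text \<open>One half of the Milnor--Schwarz lemma.\<close>

lemma subadditive_le_displacement:
  fixes u :: "('a \<Rightarrow> 'a) \<Rightarrow> real"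
  assumes u: "\<And>g h. \<lbrakk>g \<in> G; h \<in> G\<rbrakk> \<Longrightarrow> u (g \<circ> h) \<le> u g + u h"
    and "x0 \<in> K"
    and geodesic: "\<And>x y :: 'a. \<exists>p. p 0 = x \<and> p 1 = y \<and>
      (\<forall>s\<in>{0..1}. \<forall>t\<in>{0..1 :: real}. dist (p s) (p t) = \<bar>s - t\<bar> * dist x y)"
  obtains A where "A \<ge> 0" "\<And>g. g \<in> G \<Longrightarrow> u g \<le> A * dist x0 (g x0) + A"
proof -
  obtain \<delta> where \<delta>: "\<delta> > 0" "finite (returns \<delta>)" using finite_returns by blast
  define U where "U = (\<Sum>s\<in>returns \<delta>. \<bar>u s\<bar>)"
  have U: "U \<ge> 0" "u s \<le> U" if "s \<in> returns \<delta>" for s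
    using member_le_sum[of s "returns \<delta>" "\<lambda>s. \<bar>u s\<bar>"] that \<delta>(2) by (auto simp: U_def sum_nonneg)
  have U0: "U \<ge> 0" by (simp add: U_def sum_nonneg)
  have bound: "u g \<le> (dist x0 (g x0) / \<delta> + 2) * U" if g: "g \<in> G" for g
  proof -
    define l where "l = dist x0 (g x0)"
    \<comment> \<open>Rounding down and adding 1 makes each piece strictly shorter than \<delta> and
      keeps \<open>m\<close> positive when \<open>l = 0\<close>.\<close>
    define m where "m = nat \<lfloor>l / \<delta>\<rfloor> + 1"
    have l: "l \<ge> 0" by (simp add: l_def)
    then have "l / \<delta> \<ge> 0" using \<delta>(1) by simp
    then have m: "l / \<delta> < real m" "real m \<le> l / \<delta> + 1" "m > 0" unfolding m_def by linarith+
    then have lm: "l / real m < \<delta>" using \<delta>(1) by (simp add: field_simps)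
    obtain p where p: "p 0 = x0" "p 1 = g x0"
      "\<And>s t. s \<in> {0..1} \<Longrightarrow> t \<in> {0..1 :: real} \<Longrightarrow> dist (p s) (p t) = \<bar>s - t\<bar> * l"
      using geodesic[of x0 "g x0"] unfolding l_def by blast
    \<comment> \<open>The claim covers every \<open>h\<close> whose translate of \<open>K\<close>
      contains the \<open>i\<close>-th division point. Each step multiplies by one element of
      \<open>returns \<delta>\<close>; the extra 1 pays for the start, where \<open>x0\<close> may
      lie in several translates.\<close>
    have "u h \<le> (real i + 1) * U" if "i \<le> m" "h \<in> G" "p (real i / real m) \<in> h ` K" for i h
      using that
    proof (induction i arbitrary: h)
      case 0
      then obtain k where "k \<in> K" "x0 = h k" using p by auto
      then have "h \<in> returns \<delta>"
        using transition_mem_returns[OF id_mem 0(2) \<open>x0 \<in> K\<close>, of k] \<delta>(1) by simp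
      then show ?case using U by simp
    next
      case (Suc i)
      obtain h' where h': "h' \<in> G" "p (real i / real m) \<in> h' ` K" using translates_cover by blast
      obtain k k' where k: "k \<in> K" "p (real i / real m) = h' k" "k' \<in> K" "p (real (Suc i) / real m) = h k'"
        using h' Suc.prems by auto
      have "real i / real m \<in> {0..1}" "real (Suc i) / real m \<in> {0..1}"
        using Suc.prems m by (auto simp: field_simps)
      then have "dist (h' k) (h k') = \<bar>real i / real m - real (Suc i) / real m\<bar> * l"
        using p(3) k by metis
      also have "\<bar>real i / real m - real (Suc i) / real m\<bar> = 1 / real m"
        by (simp add: diff_divide_distrib[symmetric] abs_if)
      finally have "dist (h' k) (h k') < \<delta>" using lm by simp
      then have s: "inv h' \<circ> h \<in> returns \<delta>"
        by (intro transition_mem_returns[OF h'(1) Suc.prems(2) k(1,3)])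
      have "h = h' \<circ> (inv h' \<circ> h)" using inv_right[OF h'(1)] by (auto simp: fun_eq_iff)
      then have "u h \<le> u h' + u (inv h' \<circ> h)"
        using u[OF h'(1) comp_mem[OF inv_mem[OF h'(1)] Suc.prems(2)]] by simp
      also have "\<dots> \<le> (real i + 1) * U + U"
        using Suc.IH[OF _ h'] Suc.prems U[OF s] by (intro add_mono) auto
      finally show ?case by (simp add: algebra_simps)
    qed
    from this[of m g] have "u g \<le> (real m + 1) * U"
      using g p(2) m(3) \<open>x0 \<in> K\<close> by simp
    also have "\<dots> \<le> (l / \<delta> + 2) * U" using m U0 by (intro mult_right_mono) auto
    finally show ?thesis by (simp add: l_def)
  qed
  show ?thesis
  proof (rule that[of "max (U / \<delta>) (2 * U)"])
    fix g assume "g \<in> G"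
    have "u g \<le> (dist x0 (g x0) / \<delta> + 2) * U" by (rule bound) fact
    also have "\<dots> = U / \<delta> * dist x0 (g x0) + 2 * U" by (simp add: field_simps)
    also have "\<dots> \<le> max (U / \<delta>) (2 * U) * dist x0 (g x0) + max (U / \<delta>) (2 * U)"
      by (intro add_mono mult_right_mono) auto
    finally show "u g \<le> max (U / \<delta>) (2 * U) * dist x0 (g x0) + max (U / \<delta>) (2 * U)" .
  qed (use U0 in auto)
qed

text \<open>
  The equivariant map is an average of orbit points \<open>\<theta> g 0\<close> weighted by how close \<open>x\<close> is to \<open>g K\<close>.
\<close>

lemma equivariant_map:
  fixes \<theta> :: "('a \<Rightarrow> 'a) \<Rightarrow> 'v::euclidean_space \<Rightarrow> 'v"
  assumes H: "euclidean_isometry_group H"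
    and \<theta>: "\<And>g. g \<in> G \<Longrightarrow> \<theta> g \<in> H" "\<And>g h. \<lbrakk>g \<in> G; h \<in> G\<rbrakk> \<Longrightarrow> \<theta> (g \<circ> h) = \<theta> g \<circ> \<theta> h"
  obtains \<phi> B where "continuous_on UNIV \<phi>" "\<And>g x. g \<in> G \<Longrightarrow> \<phi> (g x) = \<theta> g (\<phi> x)"
    "\<And>g x. \<lbrakk>g \<in> G; x \<in> g ` K\<rbrakk> \<Longrightarrow> norm (\<phi> x - \<theta> g 0) \<le> B"
proof -
  interpret H: euclidean_isometry_group H by (rule H)
  obtain \<delta> where \<delta>: "\<delta> > 0" "finite (returns \<delta>)" using finite_returns by blast
  \<comment> \<open>The bump has radius \<open>\<delta> / 2\<close>, so that together with a point
    moving by less than \<open>\<delta> / 2\<close> only transitions in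
    \<open>returns \<delta>\<close> occur.\<close>
  define w where "w x = max 0 (\<delta> / 2 - infdist x K)" for x
  define F where "F x = {g \<in> G. w (inv g x) > 0}" for x
  have w_nonneg: "w x \<ge> 0" for x by (simp add: w_def)
  have F_subset: "F y \<subseteq> (\<lambda>s. g \<circ> s) ` returns \<delta>" if g: "g \<in> G" and x: "x \<in> g ` K" and y: "dist x y < \<delta> / 2"
    for g x y
  proof
    fix h assume "h \<in> F y"
    then have h: "h \<in> G" "infdist (inv h y) K < \<delta> / 2" by (auto simp: F_def w_def)
    obtain k where k: "k \<in> K" "x = g k" using x by blast
    then have "K \<noteq> {}" by blast
    then obtain k' where k': "k' \<in> K" "dist (inv h y) k' < \<delta> / 2"
      using cINF_greatest[of K "\<delta> / 2" "dist (inv h y)"] h(2)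
      by (force simp: infdist_notempty not_le)
    have "dist (g k) (h k') \<le> dist x y + dist y (h k')"
      using dist_triangle[of "g k" "h k'" y] k by simp
    also have "dist y (h k') < \<delta> / 2" using k'(2) dist_inv[OF h(1)] by simp
    finally have "dist (g k) (h k') < \<delta>" using y by simp
    then have "inv g \<circ> h \<in> returns \<delta>" by (rule transition_mem_returns[OF g h(1) k(1) k'(1)])
    moreover have "h = g \<circ> (inv g \<circ> h)" using inv_right[OF g] by (auto simp: fun_eq_iff)
    ultimately show "h \<in> (\<lambda>s. g \<circ> s) ` returns \<delta>" by blast
  qed
  define W where "W x = (\<Sum>g\<in>F x. w (inv g x))" for x
  define V where "V x = (\<Sum>g\<in>F x. w (inv g x) *\<^sub>R \<theta> g 0)" for x
  define \<phi> where "\<phi> x = V x /\<^sub>R W x" for x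
  \<comment> \<open>The support \<open>F x\<close> changes with \<open>x\<close>. Summing over a
    fixed finite superset, valid on a whole ball, is what makes continuity accessible.\<close>
  have superset: "W x = (\<Sum>g\<in>A. w (inv g x))" "V x = (\<Sum>g\<in>A. w (inv g x) *\<^sub>R \<theta> g 0)"
    if "finite A" "F x \<subseteq> A" "A \<subseteq> G" for x A
  proof -
    have "w (inv g x) = 0" if "g \<in> A - F x" for g
      using that \<open>A \<subseteq> G\<close> w_nonneg[of "inv g x"] by (auto simp: F_def less_le)
    then show "W x = (\<Sum>g\<in>A. w (inv g x))" "V x = (\<Sum>g\<in>A. w (inv g x) *\<^sub>R \<theta> g 0)"
      unfolding W_def V_def using that by (auto intro!: sum.mono_neutral_left)
  qed
  have F_finite: "finite (F x)" for x
  proof -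
    obtain g where "g \<in> G" "x \<in> g ` K" using translates_cover by blast
    then show ?thesis using F_subset[of g x x] \<delta> by (auto intro: finite_subset)
  qed
  have W_pos: "W x > 0" for x
  proof -
    obtain g where g: "g \<in> G" "x \<in> g ` K" using translates_cover by blast
    then have "w (inv g x) > 0" using \<delta>(1) by (auto simp: w_def)
    then have "g \<in> F x" using g by (simp add: F_def)
    then show ?thesis
      unfolding W_def using \<open>w (inv g x) > 0\<close> F_finite w_nonneg by (intro sum_pos2) auto
  qed
  have cont: "isCont \<phi> x" for x
  proof -
    obtain g where g: "g \<in> G" "x \<in> g ` K" using translates_cover by blast
    define A where "A = (\<lambda>s. g \<circ> s) ` returns \<delta>"
    have A: "finite A" "A \<subseteq> G" using \<delta>(2) g(1) by (auto simp: A_def returns_def comp_mem)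
    have sums: "W y = (\<Sum>g\<in>A. w (inv g y))" "V y = (\<Sum>g\<in>A. w (inv g y) *\<^sub>R \<theta> g 0)"
      if "y \<in> ball x (\<delta> / 2)" for y
      using superset[OF A(1) _ A(2), of y] F_subset[OF g, of y] that by (auto simp: A_def)
    have w_cont: "continuous_on S (\<lambda>y. w (inv h y))" if "h \<in> A" for h S
    proof -
      have "continuous_on S (inv h)"
        unfolding continuous_on_iff dist_eq[OF inv_mem[OF subsetD[OF A(2) that]]] by blast
      then show ?thesis unfolding w_def by (intro continuous_intros)
    qed
    have "continuous_on (ball x (\<delta> / 2)) (\<lambda>y. (\<Sum>g\<in>A. w (inv g y) *\<^sub>R \<theta> g 0) /\<^sub>R (\<Sum>g\<in>A. w (inv g y)))"
      using sums(1) W_pos by (intro continuous_intros w_cont) (metis less_irrefl)+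
    then have "continuous_on (ball x (\<delta> / 2)) \<phi>"
      by (rule continuous_on_eq) (simp add: \<phi>_def sums)
    then show ?thesis
      using \<delta>(1) by (simp add: continuous_on_eq_continuous_at)
  qed
  \<comment> \<open>Moving \<open>x\<close> by \<open>g\<close> permutes the weights, and an affine
    map commutes with weighted averages.\<close>
  have equi: "\<phi> (g x) = \<theta> g (\<phi> x)" if g: "g \<in> G" for g x
  proof -
    have winv: "w (inv (g \<circ> h) (g x)) = w (inv h x)" if "h \<in> G" for h
      using bij[OF g] bij[OF that] inv_left[OF g] by (simp add: o_inv_distrib)
    have F_img: "F (g x) = (\<lambda>h. g \<circ> h) ` F x"
    proof
      show "(\<lambda>h. g \<circ> h) ` F x \<subseteq> F (g x)"
        by (auto simp: F_def winv comp_mem g)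
      show "F (g x) \<subseteq> (\<lambda>h. g \<circ> h) ` F x"
      proof
        fix h assume h: "h \<in> F (g x)"
        define s where "s = inv g \<circ> h"
        have sG: "s \<in> G" using h g by (simp add: s_def F_def comp_mem inv_mem)
        have hs: "h = g \<circ> s" using inv_right[OF g] by (auto simp: s_def fun_eq_iff)
        have "s \<in> F x" using h winv[OF sG] sG by (simp add: F_def hs)
        then show "h \<in> (\<lambda>h. g \<circ> h) ` F x" using hs by blast
      qed
    qed
    have inj: "inj_on (\<lambda>h. g \<circ> h) (F x)"
      using bij_is_inj[OF bij[OF g]] by (auto intro!: inj_onI simp: fun_eq_iff inj_eq)
    have FG: "h \<in> G" if "h \<in> F x" for h using that by (simp add: F_def)
    have W_eq: "W (g x) = W x"
      unfolding W_def F_img sum.reindex[OF inj] by (intro sum.cong) (auto simp: winv FG)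
    have "V (g x) = (\<Sum>h\<in>F x. w (inv h x) *\<^sub>R (lin (\<theta> g) (\<theta> h 0) + \<theta> g 0))"
      unfolding V_def F_img sum.reindex[OF inj]
    proof (intro sum.cong refl)
      fix h assume "h \<in> F x"
      then have hG: "h \<in> G" by (rule FG)
      have "\<theta> (g \<circ> h) 0 = lin (\<theta> g) (\<theta> h 0) + \<theta> g 0"
        using \<theta>(2)[OF g hG] H.affine[OF \<theta>(1)[OF g], of "\<theta> h 0"] by simp
      then show "((\<lambda>h. w (inv h (g x)) *\<^sub>R \<theta> h 0) \<circ> (\<circ>) g) h = w (inv h x) *\<^sub>R (lin (\<theta> g) (\<theta> h 0) + \<theta> g 0)"
        by (simp add: winv[OF hG])
    qed
    also have "\<dots> = lin (\<theta> g) (V x) + W x *\<^sub>R \<theta> g 0"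
      by (simp add: V_def W_def blinfun.sum_right blinfun.scaleR_right scaleR_add_right
          sum.distrib scaleR_sum_left)
    finally have "\<phi> (g x) = lin (\<theta> g) (\<phi> x) + \<theta> g 0"
      using W_pos[of x] by (simp add: \<phi>_def W_eq scaleR_add_right blinfun.scaleR_right)
    also have "\<dots> = \<theta> g (\<phi> x)" using H.affine[OF \<theta>(1)[OF g], of "\<phi> x"] by simp
    finally show ?thesis .
  qed
  define B where "B = (\<Sum>s\<in>returns \<delta>. norm (\<theta> s 0))"
  have near: "norm (\<phi> x - \<theta> g 0) \<le> B" if g: "g \<in> G" "x \<in> g ` K" for g x
  proof -
    have Fg: "norm (\<theta> h 0 - \<theta> g 0) \<le> B" if h: "h \<in> F x" for h
    proof -
      obtain s where s: "s \<in> returns \<delta>" "h = g \<circ> s" using F_subset[OF g, of x] h \<delta>(1) by auto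
      then have sG: "s \<in> G" by (simp add: returns_def)
      have "norm (\<theta> h 0 - \<theta> g 0) = dist (\<theta> g (\<theta> s 0)) (\<theta> g 0)"
        using \<theta>(2)[OF g(1) sG] by (simp add: s dist_norm)
      also have "\<dots> = norm (\<theta> s 0)"
        using H.dist_eq[OF \<theta>(1)[OF g(1)], of "\<theta> s 0" 0] by simp
      also have "\<dots> \<le> B" unfolding B_def using s(1) \<delta>(2) by (intro member_le_sum) auto
      finally show ?thesis .
    qed
    have "\<phi> x - \<theta> g 0 = (\<Sum>h\<in>F x. w (inv h x) *\<^sub>R (\<theta> h 0 - \<theta> g 0)) /\<^sub>R W x"
      using W_pos[of x]
      by (simp add: \<phi>_def V_def scaleR_diff_right sum_subtractf flip: scaleR_sum_left)
        (simp add: W_def[symmetric])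
    then have "norm (\<phi> x - \<theta> g 0) = norm (\<Sum>h\<in>F x. w (inv h x) *\<^sub>R (\<theta> h 0 - \<theta> g 0)) / W x"
      using W_pos[of x] by (simp add: divide_inverse mult.commute)
    also have "\<dots> \<le> (\<Sum>h\<in>F x. w (inv h x) * B) / W x"
    proof (intro divide_right_mono order_trans[OF norm_sum] sum_mono)
      fix h assume "h \<in> F x"
      then show "norm (w (inv h x) *\<^sub>R (\<theta> h 0 - \<theta> g 0)) \<le> w (inv h x) * B"
        using Fg w_nonneg by (simp add: mult_left_mono)
    qed (use W_pos[of x] in simp)
    also have "\<dots> = B" using W_pos[of x] by (simp add: W_def flip: sum_distrib_right)
    finally show ?thesis .
  qed
  show ?thesis
    by (rule that[of \<phi> B]) (use cont equi near in \<open>auto simp: continuous_at_imp_continuous_on\<close>)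
qed

end

section \<open>The equivariant rough isometry\<close>

text \<open>The witness is the quotient topology itself: \<open>K\<close> meets every orbit, so its
  continuous image is the whole orbit space.\<close>

lemma compact_quotientI:
  fixes \<rho> :: "'g \<Rightarrow> 'a::metric_space \<Rightarrow> 'a"
  assumes "compact K" and K: "\<And>x. \<exists>y\<in>K. (\<lambda>g. \<rho> g y) ` G = (\<lambda>g. \<rho> g x) ` G"
  shows "compact_quotient G \<rho>"
proof -
  define q where "q x = (\<lambda>g. \<rho> g x) ` G" for x
  define Q where "Q = topology (\<lambda>U. U \<subseteq> range q \<and> open (q -` U))"
  have "istopology (\<lambda>U. U \<subseteq> range q \<and> open (q -` U))"
    unfolding istopology_def by (auto simp: vimage_Union intro!: open_Int open_UN)
  then have Q: "openin Q U \<longleftrightarrow> U \<subseteq> range q \<and> open (q -` U)" for U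
    by (simp add: Q_def topology_inverse')
  have top: "topspace Q = range q"
  proof
    have "q -` range q = UNIV" by auto
    then show "range q \<subseteq> topspace Q" by (intro openin_subset) (simp add: Q)
    show "topspace Q \<subseteq> range q" using openin_topspace[of Q] unfolding Q by (rule conjunct1)
  qed
  have quot: "quotient_map euclidean Q q"
    unfolding quotient_map_def by (auto simp: top Q vimage_def)
  have "compactin Q (q ` K)"
    using assms(1) quotient_imp_continuous_map[OF quot]
    by (intro image_compactin[where X = euclidean]) auto
  moreover have "q ` K = topspace Q"
  proof
    show "topspace Q \<subseteq> q ` K"
      unfolding top
    proof
      fix u assume "u \<in> range q"
      then obtain x where "u = q x" by blast
      moreover obtain y where "y \<in> K" "q y = q x" using K[of x] unfolding q_def by blast
      ultimately show "u \<in> q ` K" by (metis image_eqI)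
    qed
  qed (auto simp: top)
  ultimately have "compact_space Q" by (simp add: compact_space_def)
  with quot show ?thesis unfolding compact_quotient_def q_def[abs_def] by blast
qed

lemma geodesic_space_param:
  assumes "geodesic_space TYPE('a::metric_space)"
  shows "\<exists>p. p 0 = x \<and> p 1 = (y :: 'a) \<and>
    (\<forall>s\<in>{0..1}. \<forall>t\<in>{0..1 :: real}. dist (p s) (p t) = \<bar>s - t\<bar> * dist x y)"
proof -
  obtain c a b l where c: "a \<le> b" "c a = x" "c b = y" "l \<ge> 0"
    "\<And>s t. s \<in> {a..b} \<Longrightarrow> t \<in> {a..b} \<Longrightarrow> dist (c t) (c s) = l * \<bar>t - s\<bar>"
    using assms unfolding geodesic_space_def geodesic_between_def by metis
  define p where "p t = c (a + t * (b - a))" for t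
  have "dist (p s) (p t) = \<bar>s - t\<bar> * dist x y" if st: "s \<in> {0..1}" "t \<in> {0..1}" for s t
  proof -
    have in_ab: "a + r * (b - a) \<in> {a..b}" if "r \<in> {0..1}" for r
      using that c(1) mult_left_le_one_le[of "b - a" r] by auto
    have "dist (p s) (p t) = l * \<bar>(s - t) * (b - a)\<bar>"
      unfolding p_def using c(5)[OF in_ab[OF st(2)] in_ab[OF st(1)]] by (simp add: algebra_simps)
    moreover have "dist x y = l * (b - a)"
      using c(5)[of b a] c(1-3) by (simp add: dist_commute)
    ultimately show ?thesis using c(1) by (simp add: abs_mult)
  qed
  then show ?thesis using c by (intro exI[of _ p]) (simp add: p_def)
qed

text \<open>Ptolemy for the pairs \<open>p\<close>, \<open>m\<close> and \<open>x\<close>,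
  \<open>y\<close>: both distances from \<open>m\<close> are half of \<open>dist x y\<close>, which
  then cancels.\<close>

lemma ptolemaic_midpoint:
  fixes x y :: "'a::metric_space"
  assumes ptolemy: "\<And>x y u v :: 'a. dist x y * dist u v \<le> dist x u * dist y v + dist x v * dist y u"
    and geodesic: "\<exists>p. p 0 = (x :: 'a) \<and> p 1 = y \<and>
      (\<forall>s\<in>{0..1}. \<forall>t\<in>{0..1 :: real}. dist (p s) (p t) = \<bar>s - t\<bar> * dist x y)"
  shows "\<exists>m. dist x m = dist x y / 2 \<and> dist m y = dist x y / 2 \<and>
    (\<forall>p. dist p m \<le> (dist p x + dist p y) / 2)"
proof -
  obtain c where c: "c 0 = x" "c 1 = y"
    "\<forall>s\<in>{0..1}. \<forall>t\<in>{0..1 :: real}. dist (c s) (c t) = \<bar>s - t\<bar> * dist x y"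
    using geodesic by blast
  define m where "m = c (1/2)"
  have m: "dist x m = dist x y / 2" "dist m y = dist x y / 2"
    using c(3)[rule_format, of 0 "1/2"] c(3)[rule_format, of "1/2" 1] c(1,2) by (auto simp: m_def)
  have "dist p m \<le> (dist p x + dist p y) / 2" for p
  proof (cases "x = y")
    case True
    then show ?thesis using m by simp
  next
    case False
    have "dist p m * dist x y \<le> dist p x * dist m y + dist p y * dist m x" by (rule ptolemy)
    also have "\<dots> = (dist p x + dist p y) / 2 * dist x y"
      by (simp only: dist_commute[of m x] m) (simp add: algebra_simps)
    finally show ?thesis using False by simp
  qed
  with m show ?thesis by blast
qed

section \<open>One group acting on the Ptolemy space and on Euclidean space\<close>

locale crystallographic_action =
  X: proper_cocompact_group G K + H: crystallographic_group H
  for G :: "('a::metric_space \<Rightarrow> 'a) set" and K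
    and H :: "('v::euclidean_space \<Rightarrow> 'v) set" +
  fixes \<theta> :: "('a \<Rightarrow> 'a) \<Rightarrow> 'v \<Rightarrow> 'v" and x0 :: 'a
  assumes \<theta>_bij: "bij_betw \<theta> G H"
    and \<theta>_comp: "\<lbrakk>g \<in> G; h \<in> G\<rbrakk> \<Longrightarrow> \<theta> (g \<circ> h) = \<theta> g \<circ> \<theta> h"
    and x0: "x0 \<in> K"
    and geodesic: "\<exists>p. p 0 = (x :: 'a) \<and> p 1 = y \<and>
      (\<forall>s\<in>{0..1}. \<forall>t\<in>{0..1 :: real}. dist (p s) (p t) = \<bar>s - t\<bar> * dist x y)"
    and ptolemy: "dist x y * dist x' (y' :: 'a) \<le> dist x x' * dist y y' + dist x y' * dist y x'"
begin

lemma \<theta>_mem: "g \<in> G \<Longrightarrow> \<theta> g \<in> H"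
  using \<theta>_bij by (auto simp: bij_betw_def)

lemma \<theta>_inj: "\<lbrakk>g \<in> G; h \<in> G; \<theta> g = \<theta> h\<rbrakk> \<Longrightarrow> g = h"
  using \<theta>_bij by (auto simp: bij_betw_def inj_on_def)

abbreviation \<theta>inv :: "('v \<Rightarrow> 'v) \<Rightarrow> 'a \<Rightarrow> 'a" where
  "\<theta>inv \<equiv> inv_into G \<theta>"

lemma \<theta>inv_mem: "h \<in> H \<Longrightarrow> \<theta>inv h \<in> G"
  using \<theta>_bij by (auto simp: bij_betw_def inv_into_into)

lemma \<theta>_\<theta>inv: "h \<in> H \<Longrightarrow> \<theta> (\<theta>inv h) = h"
  using \<theta>_bij by (auto simp: bij_betw_def f_inv_into_f)

lemma \<theta>inv_eqI: "\<lbrakk>g \<in> G; \<theta> g = h\<rbrakk> \<Longrightarrow> \<theta>inv h = g"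
  using \<theta>_bij by (auto simp: bij_betw_def inv_into_f_f)

definition \<tau> :: "'v \<Rightarrow> 'a \<Rightarrow> 'a" where
  "\<tau> v = \<theta>inv ((+) v)"

lemma \<tau>_mem: "v \<in> H.translation_lattice \<Longrightarrow> \<tau> v \<in> G"
  and \<theta>_\<tau>: "v \<in> H.translation_lattice \<Longrightarrow> \<theta> (\<tau> v) = (+) v"
  by (simp_all add: \<tau>_def H.translation_lattice_def \<theta>inv_mem \<theta>_\<theta>inv)

lemma \<tau>_add:
  assumes "v \<in> H.translation_lattice" "w \<in> H.translation_lattice"
  shows "\<tau> (v + w) = \<tau> v \<circ> \<tau> w"
  unfolding \<tau>_def[of "v + w"] using assms
  by (intro \<theta>inv_eqI) (auto simp: X.comp_mem \<tau>_mem \<theta>_comp \<theta>_\<tau> fun_eq_iff add.assoc)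

lemma \<tau>_0: "\<tau> 0 x = x"
proof -
  have "\<tau> 0 (\<tau> 0 x) = \<tau> 0 x"
    using \<tau>_add[OF H.translation_lattice_0 H.translation_lattice_0] by (simp add: fun_eq_iff)
  then show ?thesis
    using X.bij[OF \<tau>_mem[OF H.translation_lattice_0]] by (simp add: bij_is_inj inj_eq)
qed

text \<open>One lattice vector has to approximate the same group element in both spaces. Finite
  index gives this: the discrepancy depends only on one of finitely many coset
  representatives.\<close>

lemma orbit_near_lattice:
  obtains M where "\<And>g. g \<in> G \<Longrightarrow> \<exists>v\<in>H.translation_lattice. dist (g x0) (\<tau> v x0) \<le> M \<and> norm (\<theta> g 0 - v) \<le> M"
proof -
  obtain F where F: "finite F" "F \<subseteq> H"
    "\<And>h. h \<in> H \<Longrightarrow> \<exists>f\<in>F. \<exists>v\<in>H.translation_lattice. h = (+) v \<circ> f"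
    using H.finite_index by metis
  define M where "M = (\<Sum>f\<in>F. dist (\<theta>inv f x0) x0 + norm (f 0))"
  have M: "dist (\<theta>inv f x0) x0 + norm (f 0) \<le> M" if "f \<in> F" for f
    unfolding M_def using that F(1)
    by (intro member_le_sum[where f = "\<lambda>f. dist (\<theta>inv f x0) x0 + norm (f 0)"]) auto
  have "\<exists>v\<in>H.translation_lattice. dist (g x0) (\<tau> v x0) \<le> M \<and> norm (\<theta> g 0 - v) \<le> M" if g: "g \<in> G" for g
  proof -
    obtain f v where f: "f \<in> F" "v \<in> H.translation_lattice" "\<theta> g = (+) v \<circ> f"
      using F(3)[OF \<theta>_mem[OF g]] by blast
    have fH: "f \<in> H" using f F by blast
    have "g = \<tau> v \<circ> \<theta>inv f"
      using f fH by (intro \<theta>_inj g X.comp_mem \<tau>_mem \<theta>inv_mem) (simp_all add: \<theta>_comp \<tau>_mem \<theta>inv_mem \<theta>_\<tau> \<theta>_\<theta>inv)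
    then have "dist (g x0) (\<tau> v x0) = dist (\<theta>inv f x0) x0"
      using X.dist_eq[OF \<tau>_mem[OF f(2)]] by simp
    moreover have "norm (\<theta> g 0 - v) = norm (f 0)" by (simp add: f(3))
    ultimately show ?thesis
      using M[OF f(1)] f(2) zero_le_dist[of "\<theta>inv f x0" x0] norm_ge_zero[of "f 0"]
      by (intro bexI[of _ v]) (auto simp del: zero_le_dist norm_ge_zero)
  qed
  then show ?thesis using that by blast
qed

lemma dist_translate_x0:
  obtains M where "\<And>g x. \<lbrakk>g \<in> G; x \<in> g ` K\<rbrakk> \<Longrightarrow> dist x (g x0) \<le> M"
proof -
  obtain M where M: "\<And>k. k \<in> K \<Longrightarrow> dist x0 k \<le> M"
    using compact_imp_bounded[OF X.compact_K] unfolding bounded_any_center[of _ x0] by blast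
  show ?thesis
  proof (rule that[of M])
    fix g x assume "g \<in> G" "x \<in> g ` K"
    then show "dist x (g x0) \<le> M" using M by (auto simp: X.dist_eq dist_commute)
  qed
qed

sublocale L: lattice_action H.translation_lattice \<tau> x0
proof
  fix v w assume v: "v \<in> H.translation_lattice"
  then show "- v \<in> H.translation_lattice" by (rule H.translation_lattice_uminus)
  show "dist (\<tau> v x) (\<tau> v y) = dist x y" for x y by (rule X.dist_eq[OF \<tau>_mem[OF v]])
  assume w: "w \<in> H.translation_lattice"
  show "v + w \<in> H.translation_lattice" by (intro H.translation_lattice_add v w)
  show "\<tau> (v + w) x = \<tau> v (\<tau> w x)" for x by (simp add: \<tau>_add v w)
next
  show "0 \<in> H.translation_lattice" by (rule H.translation_lattice_0)
  show "\<tau> 0 x = x" for x by (rule \<tau>_0)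
  show "finite {v \<in> H.translation_lattice. norm v \<le> r}" for r
  proof (rule finite_surj[OF H.finite_bounded[of r]])
    show "{v \<in> H.translation_lattice. norm v \<le> r} \<subseteq> (\<lambda>h. h 0) ` {h \<in> H. norm (h 0) \<le> r}"
    proof
      fix v assume "v \<in> {v \<in> H.translation_lattice. norm v \<le> r}"
      then show "v \<in> (\<lambda>h. h 0) ` {h \<in> H. norm (h 0) \<le> r}"
        by (intro image_eqI[of _ _ "(+) v"]) (simp_all add: H.translation_lattice_def)
    qed
  qed
  show "\<exists>R. \<forall>x. \<exists>v\<in>H.translation_lattice. norm (x - v) \<le> R" by (rule H.translation_lattice_cobounded)
  show "\<exists>R. \<forall>x. \<exists>v\<in>H.translation_lattice. dist x (\<tau> v x0) \<le> R"
  proof -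
    obtain M where M: "\<And>g. g \<in> G \<Longrightarrow> \<exists>v\<in>H.translation_lattice. dist (g x0) (\<tau> v x0) \<le> M \<and> norm (\<theta> g 0 - v) \<le> M"
      using orbit_near_lattice by blast
    obtain M' where M': "\<And>g x. \<lbrakk>g \<in> G; x \<in> g ` K\<rbrakk> \<Longrightarrow> dist x (g x0) \<le> M'"
      using dist_translate_x0 by blast
    have "\<exists>v\<in>H.translation_lattice. dist x (\<tau> v x0) \<le> M' + M" for x
    proof -
      obtain g where g: "g \<in> G" "x \<in> g ` K" using X.translates_cover by blast
      obtain v where v: "v \<in> H.translation_lattice" "dist (g x0) (\<tau> v x0) \<le> M" using M[OF g(1)] by blast
      have "dist x (\<tau> v x0) \<le> M' + M"
        using dist_triangle[of x "\<tau> v x0" "g x0"] M'[OF g] v(2) by linarith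
      then show ?thesis using v(1) by blast
    qed
    then show ?thesis by blast
  qed
  show "\<exists>c>0. \<exists>C. \<forall>v\<in>H.translation_lattice. c * norm v - C \<le> dist x0 (\<tau> v x0)"
  proof -
    \<comment> \<open>Euclidean displacement of the origin is subadditive on the group, so the
      Milnor-Schwarz bound compares it with displacement in the Ptolemy space.\<close>
    have "norm (\<theta> (g \<circ> h) 0) \<le> norm (\<theta> g 0) + norm (\<theta> h 0)" if "g \<in> G" "h \<in> G" for g h
      using norm_triangle_ineq[of "lin (\<theta> g) (\<theta> h 0)" "\<theta> g 0"] H.affine[OF \<theta>_mem[OF that(1)], of "\<theta> h 0"]
      by (simp add: \<theta>_comp that H.norm_lin[OF \<theta>_mem[OF that(1)]])
    then obtain A where A: "A \<ge> 0" "\<And>g. g \<in> G \<Longrightarrow> norm (\<theta> g 0) \<le> A * dist x0 (g x0) + A"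
      by (rule X.subadditive_le_displacement[of "\<lambda>g. norm (\<theta> g 0)" x0]) (use x0 geodesic in blast)+
    have "1 / (A + 1) * norm v - 1 \<le> dist x0 (\<tau> v x0)" if v: "v \<in> H.translation_lattice" for v
    proof -
      have "norm v \<le> A * dist x0 (\<tau> v x0) + A" using A(2)[OF \<tau>_mem[OF v]] by (simp add: \<theta>_\<tau> v)
      also have "\<dots> \<le> (A + 1) * (dist x0 (\<tau> v x0) + 1)" by (simp add: algebra_simps)
      finally show ?thesis using A(1) by (simp add: field_simps)
    qed
    then show ?thesis using A(1) by (intro exI[of _ "1 / (A + 1)"] conjI exI[of _ 1]) auto
  qed
  show "\<exists>m. dist x m = dist x y / 2 \<and> dist m y = dist x y / 2 \<and>
      (\<forall>p. dist p m \<le> (dist p x + dist p y) / 2)" for x y :: 'a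
    by (rule ptolemaic_midpoint[OF ptolemy geodesic])
  show "dist x y * dist x' y' \<le> dist x x' * dist y y' + dist x y' * dist y x'" for x y x' y' :: 'a
    by (rule ptolemy)
qed

text \<open>The element corresponding to \<open>h\<close> conjugates \<open>\<tau> v\<close> to
  \<open>\<tau> (lin h v)\<close>. Moving the base point by it costs its displacement twice, an
  error independent of \<open>v\<close>.\<close>

lemma D_lin_le:
  assumes h: "h \<in> H" and v: "v \<in> H.translation_lattice"
  shows "L.D (lin h v) \<le> L.D v + 2 * dist x0 (\<theta>inv h x0)"
proof -
  define g where "g = \<theta>inv h"
  have g: "g \<in> G" "\<theta> g = h" using h by (simp_all add: g_def \<theta>inv_mem \<theta>_\<theta>inv)
  have lv: "lin h v \<in> H.translation_lattice" by (rule H.translation_lattice_lin[OF h v])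
  have "\<tau> (lin h v) \<circ> g = g \<circ> \<tau> v"
  proof (rule \<theta>_inj)
    have "lin h v + h x = h (v + x)" for x
      using H.affine[OF h, of "v + x"] H.affine[OF h, of x] by (simp add: blinfun.add_right)
    then show "\<theta> (\<tau> (lin h v) \<circ> g) = \<theta> (g \<circ> \<tau> v)"
      by (auto simp: \<theta>_comp \<tau>_mem lv v g \<theta>_\<tau> fun_eq_iff)
  qed (simp_all add: X.comp_mem \<tau>_mem lv v g)
  then have eq: "\<tau> (lin h v) (g x0) = g (\<tau> v x0)" by (metis comp_apply)
  have "dist x0 (\<tau> (lin h v) x0) \<le> dist x0 (g x0) + dist (g x0) (\<tau> (lin h v) (g x0)) + dist (\<tau> (lin h v) (g x0)) (\<tau> (lin h v) x0)"
    using dist_triangle[of x0 "\<tau> (lin h v) x0" "g x0"] dist_triangle[of "g x0" "\<tau> (lin h v) x0" "\<tau> (lin h v) (g x0)"]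
    by linarith
  also have "dist (g x0) (\<tau> (lin h v) (g x0)) = dist x0 (\<tau> v x0)"
    unfolding eq by (rule X.dist_eq[OF g(1)])
  also have "dist (\<tau> (lin h v) (g x0)) (\<tau> (lin h v) x0) = dist x0 (g x0)"
    using X.dist_eq[OF \<tau>_mem[OF lv]] by (simp add: dist_commute)
  finally show ?thesis by (simp add: L.D_def g_def)
qed

theorem equivariant_rough_isometry:
  obtains \<rho> :: "('a \<Rightarrow> 'a) \<Rightarrow> 'v \<Rightarrow> 'v" and \<phi> :: "'a \<Rightarrow> 'v"
  where "\<And>g. g \<in> G \<Longrightarrow> bij (\<rho> g)" "\<And>g x y. g \<in> G \<Longrightarrow> dist (\<rho> g x) (\<rho> g y) = dist x y"
    "\<And>g h. \<lbrakk>g \<in> G; h \<in> G\<rbrakk> \<Longrightarrow> \<rho> (g \<circ> h) = \<rho> g \<circ> \<rho> h"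
    "compact_quotient G \<rho>" "continuous_on UNIV \<phi>" "rough_isometry \<phi>"
    "\<And>g x. g \<in> G \<Longrightarrow> \<phi> (g x) = \<rho> g (\<phi> x)"
proof -
  let ?T = "H.translation_lattice"
  obtain N B where "ptolemaic_norm N" and N_near: "\<And>v. v \<in> ?T \<Longrightarrow> \<bar>L.D v - N v\<bar> \<le> B"
    and N_inv: "\<And>L B' x. \<lbrakk>linear L; \<And>x. norm (L x) = norm x;
       \<And>v. v \<in> ?T \<Longrightarrow> L v \<in> ?T \<and> L.D (L v) \<le> L.D v + B'\<rbrakk> \<Longrightarrow> N (L x) \<le> N x"
    by (rule L.asymptotic_norm) blast
  interpret N: ptolemaic_norm N by fact
  obtain E :: "'v \<Rightarrow>\<^sub>L 'v" where E: "\<And>x. norm (E x) = N x" using N.euclidean by blast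
  have lin_E: "linear (blinfun_apply E)" by (simp add: blinfun.bounded_linear_right bounded_linear.linear)
  have "inj E"
  proof (rule injI)
    fix x y assume "E x = E y"
    then have "N (x - y) = 0" by (simp add: E[symmetric] blinfun.diff_right)
    then show "x = y" using N.N_definite[of "x - y"] by simp
  qed
  then obtain R where R: "linear R" "\<And>x. R (E x) = x" "\<And>y. E (R y) = y"
    using linear_injective_isomorphism[OF lin_E] by blast
  have N_lin_le: "N (lin h x) \<le> N x" if h: "h \<in> H" for h x
  proof (rule N_inv[where B' = "2 * dist x0 (\<theta>inv h x0)"])
    show "linear (blinfun_apply (lin h))" by (simp add: blinfun.bounded_linear_right bounded_linear.linear)
    show "norm (lin h x) = norm x" for x by (rule H.norm_lin[OF h])
    show "lin h v \<in> ?T \<and> L.D (lin h v) \<le> L.D v + 2 * dist x0 (\<theta>inv h x0)" if "v \<in> ?T" for v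
      using D_lin_le[OF h that] H.translation_lattice_lin[OF h that] by blast
  qed
  have N_lin: "N (lin h x) = N x" if h: "h \<in> H" for h x
    using N_lin_le[OF h, of x] N_lin_le[OF H.inv_mem[OF h], of "lin h x"] H.lin_inv_left[OF h] by simp
  obtain \<phi>0 B1 where \<phi>0: "continuous_on UNIV \<phi>0" "\<And>g x. g \<in> G \<Longrightarrow> \<phi>0 (g x) = \<theta> g (\<phi>0 x)"
    and \<phi>0_near: "\<And>g x. \<lbrakk>g \<in> G; x \<in> g ` K\<rbrakk> \<Longrightarrow> norm (\<phi>0 x - \<theta> g 0) \<le> B1"
  proof (rule X.equivariant_map[of H \<theta>])
    show "euclidean_isometry_group H" by (rule H.euclidean_isometry_group_axioms)
  qed (simp_all add: \<theta>_mem \<theta>_comp, rule that)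
  \<comment> \<open>\<theta> acts by isometries of the norm it came with. Conjugation by
    \<open>E\<close> turns \<open>N\<close> into the Euclidean norm, and \<open>N_lin\<close> keeps
    the action isometric.\<close>
  define \<rho> where "\<rho> g = E \<circ> \<theta> g \<circ> R" for g
  define \<phi> where "\<phi> = E \<circ> \<phi>0"
  have dist_E: "dist (E x) (E y) = N (x - y)" for x y
    by (simp add: dist_norm E[symmetric] blinfun.diff_right)
  obtain c where c: "c > 0" "\<And>x. N x \<le> c * norm x" using N.N_bounded by blast
  obtain R1 where R1: "\<And>x. \<exists>v\<in>?T. norm (x - v) \<le> R1" using H.translation_lattice_cobounded by blast
  have \<rho>_comp: "\<rho> (g \<circ> h) = \<rho> g \<circ> \<rho> h" if "g \<in> G" "h \<in> G" for g h
    using that by (auto simp: \<rho>_def \<theta>_comp R fun_eq_iff)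
  have \<rho>_translation: "\<rho> (\<tau> v) x = E (v + R x)" if "v \<in> ?T" for v x
    by (simp add: \<rho>_def \<theta>_\<tau> that)
  have bij: "bij (\<rho> g)" if "g \<in> G" for g
  proof -
    have "bij E" "bij R" by (auto intro!: o_bij[of R E] o_bij[of E R] simp: R fun_eq_iff)
    then show ?thesis
      unfolding \<rho>_def using H.bij[OF \<theta>_mem[OF that]] by (simp add: bij_comp)
  qed
  have iso: "dist (\<rho> g x) (\<rho> g y) = dist x y" if "g \<in> G" for g x y
  proof -
    have "dist (\<rho> g x) (\<rho> g y) = N (\<theta> g (R x) - \<theta> g (R y))" by (simp add: \<rho>_def dist_E)
    also have "\<theta> g (R x) - \<theta> g (R y) = lin (\<theta> g) (R x - R y)"
      using H.affine[OF \<theta>_mem[OF that], of "R x"] H.affine[OF \<theta>_mem[OF that], of "R y"]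
      by (simp add: blinfun.diff_right)
    also have "N \<dots> = dist (E (R x)) (E (R y))" by (simp add: N_lin \<theta>_mem that dist_E)
    finally show ?thesis by (simp add: R)
  qed
  have quotient: "compact_quotient G \<rho>"
  proof (rule compact_quotientI)
    show "compact (E ` cball 0 R1)"
      by (intro compact_continuous_image compact_cball linear_continuous_on blinfun.bounded_linear_right)
    fix x
    obtain v where v: "v \<in> ?T" "norm (R x - v) \<le> R1" using R1 by blast
    define g where "g = \<tau> (- v)"
    have mv: "- v \<in> ?T" by (rule H.translation_lattice_uminus[OF v(1)])
    have g: "g \<in> G" unfolding g_def by (rule \<tau>_mem[OF mv])
    have "\<rho> g x = E (R x - v)" unfolding g_def by (simp add: \<rho>_translation mv)
    then have "\<rho> g x \<in> E ` cball 0 R1" using v(2) by auto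
    moreover have "(\<lambda>h. \<rho> h (\<rho> g x)) ` G = (\<lambda>h. \<rho> h x) ` G"
    proof
      show "(\<lambda>h. \<rho> h (\<rho> g x)) ` G \<subseteq> (\<lambda>h. \<rho> h x) ` G"
      proof
        fix y assume "y \<in> (\<lambda>h. \<rho> h (\<rho> g x)) ` G"
        then obtain h where h: "h \<in> G" "y = \<rho> h (\<rho> g x)" by blast
        then have "y = \<rho> (h \<circ> g) x" by (simp add: \<rho>_comp g)
        then show "y \<in> (\<lambda>h. \<rho> h x) ` G" using X.comp_mem[OF h(1) g] by blast
      qed
      show "(\<lambda>h. \<rho> h x) ` G \<subseteq> (\<lambda>h. \<rho> h (\<rho> g x)) ` G"
      proof
        fix y assume "y \<in> (\<lambda>h. \<rho> h x) ` G"
        then obtain h where h: "h \<in> G" "y = \<rho> h x" by blast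
        have "h = (h \<circ> inv g) \<circ> g" using X.inv_left[OF g] by (auto simp: fun_eq_iff)
        then have "y = \<rho> (h \<circ> inv g) (\<rho> g x)"
          using \<rho>_comp[OF X.comp_mem[OF h(1) X.inv_mem[OF g]] g] h(2) by (metis comp_apply)
        then show "y \<in> (\<lambda>h. \<rho> h (\<rho> g x)) ` G" using X.comp_mem[OF h(1) X.inv_mem[OF g]] by blast
      qed
    qed
    ultimately show "\<exists>y\<in>E ` cball 0 R1. (\<lambda>g. \<rho> g y) ` G = (\<lambda>g. \<rho> g x) ` G" by blast
  qed
  have cont: "continuous_on UNIV \<phi>"
    unfolding \<phi>_def by (intro continuous_on_compose \<phi>0(1) linear_continuous_on blinfun.bounded_linear_right)
  have equi: "\<phi> (g x) = \<rho> g (\<phi> x)" if "g \<in> G" for g x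
    by (simp add: \<phi>_def \<rho>_def \<phi>0(2) that R)
  obtain M where M: "\<And>x. \<exists>v\<in>?T. dist x (\<tau> v x0) \<le> M \<and> norm (\<phi>0 x - v) \<le> M"
  proof -
    obtain M where M: "\<And>g. g \<in> G \<Longrightarrow> \<exists>v\<in>?T. dist (g x0) (\<tau> v x0) \<le> M \<and> norm (\<theta> g 0 - v) \<le> M"
      using orbit_near_lattice by blast
    obtain M' where M': "\<And>g x. \<lbrakk>g \<in> G; x \<in> g ` K\<rbrakk> \<Longrightarrow> dist x (g x0) \<le> M'"
      using dist_translate_x0 by blast
    have "\<exists>v\<in>?T. dist x (\<tau> v x0) \<le> max M' B1 + M \<and> norm (\<phi>0 x - v) \<le> max M' B1 + M" for x
    proof -
      obtain g where g: "g \<in> G" "x \<in> g ` K" using X.translates_cover by blast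
      obtain v where v: "v \<in> ?T" "dist (g x0) (\<tau> v x0) \<le> M" "norm (\<theta> g 0 - v) \<le> M" using M[OF g(1)] by blast
      have "dist x (\<tau> v x0) \<le> M' + M"
        using dist_triangle[of x "\<tau> v x0" "g x0"] M'[OF g] v(2) by linarith
      moreover have "norm (\<phi>0 x - v) \<le> B1 + M"
        using norm_triangle_ineq[of "\<phi>0 x - \<theta> g 0" "\<theta> g 0 - v"] \<phi>0_near[OF g] v(3) by simp
      ultimately show ?thesis using v(1) by (intro bexI[of _ v]) auto
    qed
    then show ?thesis using that by blast
  qed
  have rough: "rough_isometry \<phi>"
  proof -
    \<comment> \<open>The first term collects the passage to orbit points in the Ptolemy space, the
      distance of \<open>D\<close> from \<open>N\<close>, and the passage to lattice points measured
      by \<open>N\<close>. The second is for coarse surjectivity: rounding to the lattice plus the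
      offset of \<open>\<phi>0 x0\<close> from the origin.\<close>
    define A where "A = \<bar>2 * M + B + c * (2 * M)\<bar> + \<bar>c * (R1 + norm (\<phi>0 x0))\<bar>"
    have close: "\<bar>dist (\<phi> x) (\<phi> x') - dist x x'\<bar> \<le> A" for x x'
    proof -
      obtain v where v: "v \<in> ?T" "dist x (\<tau> v x0) \<le> M" "norm (\<phi>0 x - v) \<le> M" using M by blast
      obtain w where w: "w \<in> ?T" "dist x' (\<tau> w x0) \<le> M" "norm (\<phi>0 x' - w) \<le> M" using M by blast
      have vw: "v - w \<in> ?T" by (rule L.T_diff[OF v(1) w(1)])
      have "dist (\<tau> w x0) (\<tau> v x0) = L.D (v - w)" by (rule L.dist_orbit[OF w(1) v(1)])
      then have 1: "\<bar>dist x x' - L.D (v - w)\<bar> \<le> 2 * M"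
        using v(2) w(2) dist_triangle[of x x' "\<tau> v x0"] dist_triangle[of "\<tau> v x0" x' "\<tau> w x0"]
          dist_triangle[of "\<tau> w x0" "\<tau> v x0" x'] dist_triangle[of x' "\<tau> v x0" x]
        by (simp add: dist_commute abs_le_iff)
      define e where "e = (\<phi>0 x - \<phi>0 x') - (v - w)"
      have "norm e \<le> 2 * M"
        using norm_triangle_ineq4[of "\<phi>0 x - v" "\<phi>0 x' - w"] v(3) w(3) by (simp add: e_def algebra_simps)
      then have "c * norm e \<le> c * (2 * M)" using c(1) by simp
      then have Ne: "N e \<le> c * (2 * M)" using c(2)[of e] by linarith
      have "N (\<phi>0 x - \<phi>0 x') \<le> N (v - w) + N e"
        using N.N_triangle[of "v - w" e] by (simp add: e_def)
      moreover have "N (v - w) \<le> N (\<phi>0 x - \<phi>0 x') + N e"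
        using N.N_triangle[of "\<phi>0 x - \<phi>0 x'" "- e"] N.N_scale[of "- 1" e] by (simp add: e_def)
      ultimately have 2: "\<bar>dist (\<phi> x) (\<phi> x') - N (v - w)\<bar> \<le> c * (2 * M)"
        using Ne by (simp add: \<phi>_def dist_E)
      show ?thesis
        using 1 2 N_near[OF vw] unfolding A_def by linarith
    qed
    have "\<exists>x. dist y (\<phi> x) \<le> A" for y
    proof -
      obtain v where v: "v \<in> ?T" "norm (R y - v) \<le> R1" using R1 by blast
      have "\<phi> (\<tau> v x0) = E (v + \<phi>0 x0)"
        using \<phi>0(2)[OF \<tau>_mem[OF v(1)], of x0] by (simp add: \<phi>_def \<theta>_\<tau> v(1))
      then have "dist y (\<phi> (\<tau> v x0)) = N (R y - (v + \<phi>0 x0))"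
        using dist_E[of "R y" "v + \<phi>0 x0"] by (simp add: R)
      also have "\<dots> \<le> c * norm (R y - (v + \<phi>0 x0))" by (rule c(2))
      also have "\<dots> \<le> c * (R1 + norm (\<phi>0 x0))"
      proof (rule mult_left_mono)
        show "norm (R y - (v + \<phi>0 x0)) \<le> R1 + norm (\<phi>0 x0)"
          using norm_triangle_ineq4[of "R y - v" "\<phi>0 x0"] v(2) by (simp add: algebra_simps)
      qed (use c(1) in simp)
      also have "\<dots> \<le> A" unfolding A_def by linarith
      finally show ?thesis by blast
    qed
    moreover have "dist x x' - A \<le> dist (\<phi> x) (\<phi> x') \<and> dist (\<phi> x) (\<phi> x') \<le> dist x x' + A" for x x'
      using close[of x x'] by linarith
    moreover have "A \<ge> 0" by (simp add: A_def)
    ultimately show ?thesis unfolding rough_isometry_def by blast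
  qed
  show ?thesis
    by (rule that[OF bij iso \<rho>_comp quotient cont rough equi])
qed

end

theorem theorem1p1:
  fixes \<Gamma> :: "('a::metric_space \<Rightarrow> 'a) set"
  assumes "geodesic_space TYPE('a)"
    and "ptolemy_space TYPE('a)"
    and "subgroup \<Gamma> isometry_group"
    and "crystallographic TYPE('n::finite) (isometry_group\<lparr>carrier := \<Gamma>\<rparr>)"
    and "proper_action \<Gamma> (\<lambda>\<gamma>. \<gamma>)"
    and "cocompact_action \<Gamma> (\<lambda>\<gamma>. \<gamma>)"
  shows "\<exists>(\<rho> :: ('a \<Rightarrow> 'a) \<Rightarrow> (real ^ 'n \<Rightarrow> real ^ 'n)) (\<phi> :: 'a \<Rightarrow> real ^ 'n).
           \<rho> \<in> hom (isometry_group\<lparr>carrier := \<Gamma>\<rparr>) isometry_group \<and>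
           compact_quotient \<Gamma> \<rho> \<and>
           continuous_on UNIV \<phi> \<and>
           rough_isometry \<phi> \<and>
           (\<forall>\<gamma>\<in>\<Gamma>. \<forall>x. \<phi> (\<gamma> x) = \<rho> \<gamma> (\<phi> x))"
proof -
  obtain H :: "(real ^ 'n \<Rightarrow> real ^ 'n) set" and \<theta>
    where H: "subgroup H isometry_group" "discrete H" "cocompact_action H (\<lambda>h. h)"
      and \<theta>: "\<theta> \<in> iso (isometry_group\<lparr>carrier := \<Gamma>\<rparr>) (isometry_group\<lparr>carrier := H\<rparr>)"
    using assms(4) unfolding crystallographic_def is_iso_def by blast
  obtain K where K: "compact K" "(\<Union>\<gamma>\<in>\<Gamma>. \<gamma> ` K) = UNIV"
    using assms(6) unfolding cocompact_action_def by blast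
  obtain K' where K': "compact K'" "(\<Union>h\<in>H. h ` K') = UNIV"
    using H(3) unfolding cocompact_action_def by blast
  have "K \<noteq> {}" using K(2) by auto
  then obtain x0 where x0: "x0 \<in> K" by blast
  interpret X: isometry_action_group \<Gamma> by (rule isometry_action_group_of_subgroup[OF assms(3)])
  interpret H: isometry_action_group H by (rule isometry_action_group_of_subgroup[OF H(1)])
  interpret crystallographic_action \<Gamma> K H \<theta> x0
  proof unfold_locales
    show "compact K" "x0 \<in> K" "discrete H" by fact+
    show "\<exists>g\<in>\<Gamma>. x \<in> g ` K" for x using K(2) by blast
    show "\<exists>r>0. finite {g \<in> \<Gamma>. dist x (g x) < r}" for x
      using assms(5) unfolding proper_action_def by blast
    obtain R where R: "\<And>k. k \<in> K' \<Longrightarrow> norm k \<le> R"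
      using compact_imp_bounded[OF K'(1)] unfolding bounded_iff by blast
    have "\<exists>h\<in>H. norm (x - h 0) \<le> R" for x
    proof -
      obtain h k where h: "h \<in> H" "k \<in> K'" "x = h k" using K'(2) by blast
      then have "norm (x - h 0) = norm k" using H.dist_eq[OF h(1), of k 0] by (simp add: dist_norm)
      then show ?thesis using R[OF h(2)] h(1) by (intro bexI[of _ h]) simp_all
    qed
    then show "\<exists>R. \<forall>x. \<exists>h\<in>H. norm (x - h 0) \<le> R" by blast
    show "bij_betw \<theta> \<Gamma> H" using \<theta> by (simp add: iso_def)
    show "\<theta> (g \<circ> h) = \<theta> g \<circ> \<theta> h" if "g \<in> \<Gamma>" "h \<in> \<Gamma>" for g h
      using \<theta> that by (auto simp: iso_def hom_def isometry_group_def)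
    show "\<exists>p. p 0 = x \<and> p 1 = y \<and>
      (\<forall>s\<in>{0..1}. \<forall>t\<in>{0..1 :: real}. dist (p s) (p t) = \<bar>s - t\<bar> * dist x y)" for x y :: 'a
      by (rule geodesic_space_param[OF assms(1)])
    show "dist x y * dist x' y' \<le> dist x x' * dist y y' + dist x y' * dist y x'" for x y x' y' :: 'a
      using assms(2) unfolding ptolemy_space_def by blast
  qed
  obtain \<rho> :: "('a \<Rightarrow> 'a) \<Rightarrow> real ^ 'n \<Rightarrow> real ^ 'n" and \<phi> :: "'a \<Rightarrow> real ^ 'n"
    where \<rho>: "\<And>g. g \<in> \<Gamma> \<Longrightarrow> bij (\<rho> g)" "\<And>g x y. g \<in> \<Gamma> \<Longrightarrow> dist (\<rho> g x) (\<rho> g y) = dist x y"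
      "\<And>g h. \<lbrakk>g \<in> \<Gamma>; h \<in> \<Gamma>\<rbrakk> \<Longrightarrow> \<rho> (g \<circ> h) = \<rho> g \<circ> \<rho> h"
      and \<phi>: "compact_quotient \<Gamma> \<rho>" "continuous_on UNIV \<phi>" "rough_isometry \<phi>"
        "\<And>g x. g \<in> \<Gamma> \<Longrightarrow> \<phi> (g x) = \<rho> g (\<phi> x)"
    by (rule equivariant_rough_isometry) blast
  have "\<rho> \<in> hom (isometry_group\<lparr>carrier := \<Gamma>\<rparr>) isometry_group"
    using \<rho> by (auto simp: hom_def isometry_group_def)
  with \<phi> show ?thesis by blast
qed

end
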